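(* Let $G$ be an $(n,d,\lambda)$-graph with $d>500\lambda$, with $n$ sufficiently large, and let $\mathcal{M}$ be a collection of pairwise disjoint pairs $\{x,y\}\subseteq V(G)$ (where $x=y$ is allowed) such that $V(\mathcal{M})$ is $500\lambda$-clean in $G$ and $|\mathcal{M}|\ge 2000\lambda n/d$. Let $\mathcal{P}$ be a collection of at most $\frac{|\mathcal{M}|}{100\log_2 n}$ pairwise disjoint pairs $\{a_i,b_i\}$ of vertices in $V(G)\setminus V(\mathcal{M})$ such that every vertex $v\in V(\mathcal{P})$ satisfies $|N(v)\cap V(\mathcal{M})|\ge 500\lambda$. Then there exist pairwise vertex-disjoint $\mathcal{M}$-alternating paths in $G\cup\mathcal{M}$, one between each pair $\{a_i,b_i\}\in\mathcal{P}$.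
   Context: An $(n,d,\lambda)$-graph is an $n$-vertex $d$-regular graph whose second largest eigenvalue in absolute value is at most $\lambda$. For a collection $\mathcal{M}$ of disjoint sets, $V(\mathcal{M})$ is the union of its members; $V(\mathcal{P})$ likewise. A set $S\subseteq V(G)$ is $\delta$-clean if $G[S]$ has minimum degree at least $\delta$. $N(v)$ is the neighbourhood of $v$ in $G$. $G\cup\mathcal{M}$ denotes the graph obtained from $G$ by adding the edge $xy$ for every pair $\{x,y\}\in\mathcal{M}$ with $x\ne y$ (if not already present). A path in $G\cup\mathcal{M}$ is $\mathcal{M}$-alternating if it is of the form $e_1f_1e_2f_2\dots$ where the $e_i$ are edges of $G$ and each $f_i$ is either an edge $xy$ with $\{x,y\}\in\mathcal{M}$, $x\neq y$, or a single vertex $x$ with $\{x,x\}\in\mathcal{M}$; i.e., every step through a pair of $\mathcal{M}$ is preceded and followed by an edge of $G$. *)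

theory Defs
  imports "Jordan_Normal_Form.Char_Poly" "HOL-Computational_Algebra.Polynomial"
begin

definition graph_on :: "nat \<Rightarrow> (nat \<Rightarrow> nat \<Rightarrow> bool) \<Rightarrow> bool" where
  "graph_on n E \<longleftrightarrow> (\<forall>u v. E u v \<longrightarrow> u < n \<and> v < n \<and> u \<noteq> v \<and> E v u)"

definition nbhd :: "(nat \<Rightarrow> nat \<Rightarrow> bool) \<Rightarrow> nat \<Rightarrow> nat set" where
  "nbhd E v = {u. E v u}"

definition regular_graph :: "nat \<Rightarrow> nat \<Rightarrow> (nat \<Rightarrow> nat \<Rightarrow> bool) \<Rightarrow> bool" where
  "regular_graph n d E \<longleftrightarrow> graph_on n E \<and> (\<forall>v<n. card (nbhd E v) = d)"

definition adj_matrix :: "nat \<Rightarrow> (nat \<Rightarrow> nat \<Rightarrow> bool) \<Rightarrow> real mat" where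
  "adj_matrix n E = mat n n (\<lambda>(i,j). if E i j then 1 else 0)"

text \<open>Eigenvalues of the adjacency matrix, with multiplicity (roots of the characteristic
  polynomial; the matrix is real symmetric, so all eigenvalues are real).\<close>
definition adj_eigenvalues :: "nat \<Rightarrow> (nat \<Rightarrow> nat \<Rightarrow> bool) \<Rightarrow> real multiset" where
  "adj_eigenvalues n E = proots (char_poly (adj_matrix n E))"

definition second_abs_eigenvalue :: "nat \<Rightarrow> (nat \<Rightarrow> nat \<Rightarrow> bool) \<Rightarrow> real" where
  "second_abs_eigenvalue n E =
     sorted_list_of_multiset (image_mset abs (adj_eigenvalues n E)) ! (n - 2)"

definition ndl_graph :: "nat \<Rightarrow> nat \<Rightarrow> real \<Rightarrow> (nat \<Rightarrow> nat \<Rightarrow> bool) \<Rightarrow> bool" where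
  "ndl_graph n d lam E \<longleftrightarrow> regular_graph n d E \<and> n \<ge> 2 \<and> second_abs_eigenvalue n E \<le> lam"

definition clean :: "(nat \<Rightarrow> nat \<Rightarrow> bool) \<Rightarrow> real \<Rightarrow> nat set \<Rightarrow> bool" where
  "clean E delta S \<longleftrightarrow> (\<forall>v\<in>S. real (card (nbhd E v \<inter> S)) \<ge> delta)"

definition disjoint_pairs :: "nat \<Rightarrow> nat set set \<Rightarrow> bool" where
  "disjoint_pairs n M \<longleftrightarrow> finite M \<and>
     (\<forall>p\<in>M. \<exists>x y. p = {x, y} \<and> x < n \<and> y < n) \<and>
     (\<forall>p\<in>M. \<forall>q\<in>M. p \<noteq> q \<longrightarrow> p \<inter> q = {})"

text \<open>An M-alternating path e1 f1 e2 f2 ... f(k-1) ek in G \<union> M, given by its list of G-edges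
  es = [(u1,w1),...,(uk,wk)]; the step f_i joins w_i to u_(i+1) and is the pair {w_i,u_(i+1)} \<in> M
  (an edge if w_i \<noteq> u_(i+1), a single vertex if w_i = u_(i+1)). The vertex sequence of the path
  is u1 w1 u2 w2 ... uk wk with w_i, u_(i+1) identified when equal; it must have no repeated
  vertex. The path goes from a to b.\<close>
definition path_verts :: "(nat \<times> nat) list \<Rightarrow> nat list" where
  "path_verts es = remdups_adj (concat (map (\<lambda>(u,w). [u, w]) es))"

definition alt_path ::
  "(nat \<Rightarrow> nat \<Rightarrow> bool) \<Rightarrow> nat set set \<Rightarrow> nat \<Rightarrow> nat \<Rightarrow> (nat \<times> nat) list \<Rightarrow> bool" where
  "alt_path E M a b es \<longleftrightarrow> es \<noteq> [] \<and>
     (\<forall>(u,w)\<in>set es. E u w) \<and>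
     fst (hd es) = a \<and> snd (last es) = b \<and>
     (\<forall>i. Suc i < length es \<longrightarrow> {snd (es ! i), fst (es ! Suc i)} \<in> M) \<and>
     distinct (path_verts es)"

end

(* Large sets of an (n,d,lambda)-graph are joined by an edge, and sets of vertices with many neighbours
   in V(M) expand into V(M); both follow from the expander mixing lemma. Contracting the pairs of M, one
   builds vertex-disjoint trees in which every edge of G is followed by a pair of M, maintaining the
   Friedman-Pippenger extendability condition. To link a and b, grow binary trees of logarithmic
   depth and more than lambda n / d vertices from both, join them by an edge of G, and roll back all
   branches outside the resulting path, which preserves extendability. *)
theory Submission
  imports Defs "Jordan_Normal_Form.Jordan_Normal_Form_Existence" "Jordan_Normal_Form.Schur_Decomposition"
begin

section \<open>The expander mixing lemma\<close>

text \<open>Rollback is forced by the budget. With m = lam n / d, the two trees of a link occupy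
  fewer than 2^(k+2) \<le> 16 m pairs while they stand, but the path keeps at most 2k \<le> 2 log2 n
  of them. All paths together therefore hold at most |M|/50 pairs, and the cost of trees is paid
  once, not once per link. The sum stays below |M|/2, the number of used pairs that the expansion of
  large sets tolerates. The delicate point is that new trees must be able to start after a rollback:
  a pair that is free again may not contain a vertex that still serves as a parent. Hence every tree
  path records that the parents of its pairs lie on the path or at its root. On the spectral side,
  the hypothesis speaks of roots of a characteristic polynomial, whereas counting edges needs a
  bound on a bilinear form. The bridge is a norm bound for symmetric matrices, obtained from
  boundedness of matrix powers and applied after the eigenvalue d has been shifted to 0.\<close>

lemma sym_scalar_prod:
  fixes A :: "real mat"
  assumes "A \<in> carrier_mat n n" "transpose_mat A = A" "x \<in> carrier_vec n" "y \<in> carrier_vec n"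
  shows "(A *\<^sub>v x) \<bullet> y = x \<bullet> (A *\<^sub>v y)"
  using transpose_vec_mult_scalar[of A n n y x] assms by simp

lemma scalar_prod_self_nonneg: "(x :: real vec) \<bullet> x \<ge> 0"
  by (auto simp: scalar_prod_def intro!: sum_nonneg)

lemma scalar_prod_self_eq_0:
  assumes "(x :: real vec) \<in> carrier_vec n"
  shows "x \<bullet> x = 0 \<longleftrightarrow> x = 0\<^sub>v n"
  using conjugate_square_eq_0_vec[OF assms] by (simp add: conjugate_vec_def vec_eq_iff)

lemma sq_scalar_prod_le:
  fixes x y :: "real vec"
  assumes x: "x \<in> carrier_vec n" and y: "y \<in> carrier_vec n"
  shows "(x \<bullet> y)\<^sup>2 \<le> (x \<bullet> x) * (y \<bullet> y)"
proof (cases "y \<bullet> y = 0")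
  case True
  then have "y = 0\<^sub>v n" using scalar_prod_self_eq_0[OF y] by simp
  then show ?thesis using x by simp
next
  case False
  then have yy: "y \<bullet> y > 0" using scalar_prod_self_nonneg[of y] by linarith
  let ?t = "x \<bullet> y / (y \<bullet> y)"
  have "0 \<le> (x - ?t \<cdot>\<^sub>v y) \<bullet> (x - ?t \<cdot>\<^sub>v y)" by (rule scalar_prod_self_nonneg)
  also have "\<dots> = x \<bullet> x - ?t * (x \<bullet> y) - ?t * (y \<bullet> x) + ?t * (?t * (y \<bullet> y))"
    using x y by (simp add: minus_scalar_prod_distrib[of _ n] scalar_prod_minus_distrib[of _ n])
  also have "\<dots> = x \<bullet> x - (x \<bullet> y)\<^sup>2 / (y \<bullet> y)"
    using yy comm_scalar_prod[OF x y] by (simp add: power2_eq_square)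
  finally show ?thesis using yy by (simp add: field_simps)
qed

lemma mult_mat_vec_nth:
  assumes "A \<in> carrier_mat n n" "x \<in> carrier_vec n" "i < n"
  shows "(A *\<^sub>v x) $ i = (\<Sum>j\<in>{0..<n}. A $$ (i,j) * x $ j)"
  using assms by (simp add: scalar_prod_def)

section \<open>Real spectrum and operator norm of symmetric matrices\<close>

lemma real_poly_splits:
  fixes p :: "real poly"
  assumes "\<And>z. poly (map_poly complex_of_real p) z = 0 \<Longrightarrow> z \<in> \<real>" "lead_coeff p = 1"
  shows "\<exists>es. p = (\<Prod>e\<leftarrow>es. [:- e, 1:])"
  using assms
proof (induction "degree p" arbitrary: p)
  case 0
  then have "p = 1" by (metis degree_eq_zeroE lead_coeff_pCons(2) one_pCons)
  then show ?case by (intro exI[of _ "[]"]) simp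
next
  case (Suc k)
  interpret h: map_poly_inj_idom_hom complex_of_real ..
  have "degree (map_poly complex_of_real p) = Suc k" using Suc.hyps by (simp add: degree_map_poly)
  then have "\<not> constant (poly (map_poly complex_of_real p))"
    by (simp add: constant_degree)
  then obtain z where z: "poly (map_poly complex_of_real p) z = 0"
    using fundamental_theorem_of_algebra by blast
  with Suc.prems(1) obtain r where r: "z = of_real r" by (auto elim: Reals_cases)
  from z have "poly p r = 0" unfolding r by simp
  then obtain q where q: "p = [:- r, 1:] * q" by (metis dvdE poly_eq_0_iff_dvd)
  have q0: "q \<noteq> 0" using Suc.prems(2) q by auto
  have "lead_coeff q = 1" using Suc.prems(2) unfolding q by (simp only: lead_coeff_mult) simp
  moreover have "k = degree q"
    using Suc.hyps(2) q0 unfolding q by (subst (asm) degree_mult_eq) auto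
  moreover have "z \<in> \<real>" if "poly (map_poly complex_of_real q) z = 0" for z
    by (rule Suc.prems(1)) (simp only: q h.hom_mult poly_mult that mult_zero_right)
  ultimately obtain es where "q = (\<Prod>e\<leftarrow>es. [:- e, 1:])"
    using Suc.hyps(1) by blast
  then show ?case using q by (intro exI[of _ "r # es"]) simp
qed

text \<open>Split an eigenvector as v = a + ib and compare real and imaginary parts of Av = zv.
  Symmetry, in the form (Aa, b) = (a, Ab), leaves Im z (|a|^2 + |b|^2) = 0.\<close>

lemma symmetric_complex_eigenvalue_real:
  fixes A :: "real mat"
  assumes A: "A \<in> carrier_mat n n" and sym: "transpose_mat A = A"
    and ev: "eigenvalue (map_mat complex_of_real A) z"
  shows "z \<in> \<real>"
proof -
  obtain v where v: "v \<in> carrier_vec n" "v \<noteq> 0\<^sub>v n"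
    and Av: "map_mat complex_of_real A *\<^sub>v v = z \<cdot>\<^sub>v v"
    using ev A unfolding eigenvalue_def eigenvector_def by auto
  define a b where "a = map_vec Re v" and "b = map_vec Im v"
  have ab: "a \<in> carrier_vec n" "b \<in> carrier_vec n" using v by (auto simp: a_def b_def)
  have entry: "(\<Sum>j\<in>{0..<n}. complex_of_real (A $$ (i,j)) * v $ j) = z * v $ i" if "i < n" for i
  proof -
    have "(map_mat complex_of_real A *\<^sub>v v) $ i = (z \<cdot>\<^sub>v v) $ i" using Av by simp
    then show ?thesis using that A v by (simp add: scalar_prod_def)
  qed
  have Aa: "A *\<^sub>v a = Re z \<cdot>\<^sub>v a - Im z \<cdot>\<^sub>v b"
  proof (rule eq_vecI)
    fix i assume "i < dim_vec (Re z \<cdot>\<^sub>v a - Im z \<cdot>\<^sub>v b)"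
    then have i: "i < n" using ab by simp
    show "(A *\<^sub>v a) $ i = (Re z \<cdot>\<^sub>v a - Im z \<cdot>\<^sub>v b) $ i"
      using arg_cong[OF entry[OF i], of Re] i A v ab by (simp add: scalar_prod_def a_def b_def)
  qed (use A ab in simp)
  have Ab: "A *\<^sub>v b = Im z \<cdot>\<^sub>v a + Re z \<cdot>\<^sub>v b"
  proof (rule eq_vecI)
    fix i assume "i < dim_vec (Im z \<cdot>\<^sub>v a + Re z \<cdot>\<^sub>v b)"
    then have i: "i < n" using ab by simp
    show "(A *\<^sub>v b) $ i = (Im z \<cdot>\<^sub>v a + Re z \<cdot>\<^sub>v b) $ i"
      using arg_cong[OF entry[OF i], of Im] i A v ab by (simp add: scalar_prod_def a_def b_def)
  qed (use A ab in simp)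
  have "(Re z \<cdot>\<^sub>v a - Im z \<cdot>\<^sub>v b) \<bullet> b = a \<bullet> (Im z \<cdot>\<^sub>v a + Re z \<cdot>\<^sub>v b)"
    using sym_scalar_prod[OF A sym ab] Aa Ab by simp
  then have "Im z * (a \<bullet> a + b \<bullet> b) = 0"
    using ab by (simp add: minus_scalar_prod_distrib[of _ n] scalar_prod_add_distrib[of _ n] algebra_simps)
  moreover have "a \<bullet> a + b \<bullet> b \<noteq> 0"
  proof
    assume "a \<bullet> a + b \<bullet> b = 0"
    then have "a \<bullet> a = 0" "b \<bullet> b = 0"
      using scalar_prod_self_nonneg[of a] scalar_prod_self_nonneg[of b] by linarith+
    then have "a = 0\<^sub>v n" "b = 0\<^sub>v n" using scalar_prod_self_eq_0 ab by auto
    then have "v = 0\<^sub>v n"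
      using v by (auto simp: a_def b_def vec_eq_iff complex_eq_iff)
    with v show False by simp
  qed
  ultimately have "Im z = 0" by simp
  then show ?thesis by (simp add: complex_is_Real_iff)
qed

lemma symmetric_char_poly_splits:
  fixes A :: "real mat"
  assumes A: "A \<in> carrier_mat n n" and sym: "transpose_mat A = A"
  shows "\<exists>es. char_poly A = (\<Prod>e\<leftarrow>es. [:- e, 1:])"
proof (rule real_poly_splits)
  show "lead_coeff (char_poly A) = 1" using degree_monic_char_poly[OF A] by simp
  fix z assume "poly (map_poly complex_of_real (char_poly A)) z = 0"
  then have "eigenvalue (map_mat complex_of_real A) z"
    using eigenvalue_root_char_poly[of "map_mat complex_of_real A" n] A
    by (simp add: of_real_hom.char_poly_hom[OF A])
  then show "z \<in> \<real>" using symmetric_complex_eigenvalue_real[OF A sym] by blast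
qed

lemma eigenvalue_in_split:
  fixes A :: "real mat"
  assumes A: "A \<in> carrier_mat n n" and "char_poly A = (\<Prod>e\<leftarrow>es. [:- e, 1:])"
  shows "eigenvalue A r \<longleftrightarrow> r \<in> set es"
  using eigenvalue_root_char_poly[OF A, of r] assms(2)
  by (auto simp: poly_prod_list prod_list_zero_iff)

lemma length_split:
  fixes A :: "real mat"
  assumes A: "A \<in> carrier_mat n n" and "char_poly A = (\<Prod>e\<leftarrow>es. [:- e, 1:])"
  shows "length es = n"
  using degree_monic_char_poly[OF A] degree_linear_factors[of uminus es] assms(2) by simp

text \<open>By Cauchy--Schwarz the sequence $|A^k x|$ is log-convex along $k = 1, 2, 4, \dots$, so a
  symmetric matrix that expands some vector has unbounded powers.\<close>
lemma symmetric_contraction: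
  fixes A :: "real mat"
  assumes A: "A \<in> carrier_mat n n" and sym: "transpose_mat A = A"
    and ev: "\<And>r. eigenvalue A r \<Longrightarrow> \<bar>r\<bar> < 1" and x: "x \<in> carrier_vec n"
  shows "(A *\<^sub>v x) \<bullet> (A *\<^sub>v x) \<le> x \<bullet> x"
proof (rule ccontr)
  assume neg: "\<not> ?thesis"
  obtain es where es: "char_poly A = (\<Prod>e\<leftarrow>es. [:- e, 1:])"
    using symmetric_char_poly_splits[OF A sym] by blast
  have es1: "\<bar>e\<bar> < 1" if "e \<in> set es" for e
    using ev eigenvalue_in_split[OF A es] that by blast
  \<comment> \<open>The argument \<open>0\<close> bounds the multiplicity of roots of modulus
    exactly 1, of which there are none. Since \<open>0 - 1 = 0\<close> on naturals, the polynomial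
    growth bound degenerates to a constant.\<close>
  obtain c1 c2 where "\<forall>k. norm_bound (A ^\<^sub>m k) (c1 + c2 * of_nat k ^ (0 - 1))"
    using factored_char_poly_norm_bound_cof[OF A es, of 0] es1 by force
  then have "\<forall>k. norm_bound (A ^\<^sub>m k) (c1 + c2)" by simp
  then obtain c where c: "\<And>k i j. i < n \<Longrightarrow> j < n \<Longrightarrow> \<bar>(A ^\<^sub>m k) $$ (i,j)\<bar> \<le> c"
    using pow_carrier_mat[OF A] that[of "c1 + c2"] unfolding norm_bound_def real_norm_def
    by (metis carrier_matD)
  define B where "B k = (A ^\<^sub>m k) *\<^sub>v x" for k
  define a where "a k = B k \<bullet> B k" for k
  have Ak: "A ^\<^sub>m k \<in> carrier_mat n n" for k using A by simp
  have Bk: "B k \<in> carrier_vec n" for k unfolding B_def using mult_mat_vec_carrier[OF Ak x] .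
  have B0: "B 0 = x" using x A by (simp add: B_def)
  have Bsuc: "B (Suc k) = A *\<^sub>v B k" for k
  proof -
    have "A ^\<^sub>m (Suc k) = A * A ^\<^sub>m k"
    proof (induction k)
      case (Suc k)
      then show ?case using assoc_mult_mat[OF A Ak A] by (metis pow_mat.simps(2))
    qed (use A in simp)
    then show ?thesis unfolding B_def using assoc_mult_mat_vec[OF A Ak x] by simp
  qed
  \<comment> \<open>Symmetry moves factors of \<open>A\<close> across the scalar product, so the
    product of \<open>B k\<close> and \<open>B l\<close> depends on \<open>k + l\<close> only. In
    particular \<open>a k\<close> is the product of \<open>B 0\<close> and \<open>B (2 * k)\<close>,
    ready for Cauchy--Schwarz.\<close>
  have shift: "B (k + j) \<bullet> B l = B l \<bullet> B (k + j) \<and> B (k + j) \<bullet> B l = B j \<bullet> B (k + l)" for k j l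
  proof (induction k arbitrary: j l)
    case 0 then show ?case using comm_scalar_prod[OF Bk Bk] by simp
  next
    case (Suc k)
    have "B (Suc k + j) \<bullet> B l = B (k + j) \<bullet> B (Suc l)"
      using sym_scalar_prod[OF A sym Bk Bk] by (simp add: Bsuc)
    then show ?case using Suc.IH[of j "Suc l"] comm_scalar_prod[OF Bk Bk] by simp
  qed
  have conv: "(a k)\<^sup>2 \<le> a 0 * a (2 * k)" for k
  proof -
    have "a k = B 0 \<bullet> B (2 * k)" using shift[of k 0 k] by (simp add: a_def mult_2)
    then show ?thesis using sq_scalar_prod_le[OF Bk Bk, of 0 "2*k"] by (simp add: a_def)
  qed
  have a1: "a 1 > a 0" using neg by (simp add: a_def B0 Bsuc)
  have a0: "a 0 > 0"
  proof -
    have "a 0 \<noteq> 0"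
    proof
      assume "a 0 = 0"
      then have "(a 1)\<^sup>2 \<le> 0" using conv[of 1] by simp
      then show False using a1 \<open>a 0 = 0\<close> by simp
    qed
    then show ?thesis using scalar_prod_self_nonneg[of "B 0"] by (simp add: a_def)
  qed
  define q where "q = a 1 / a 0"
  have q1: "q > 1" using a0 a1 by (simp add: q_def)
  \<comment> \<open>By \<open>conv\<close>, doubling the index at least squares the ratio to
    \<open>a 0\<close>. As \<open>q > 1\<close>, the ratios at powers of two are unbounded, which
    the uniform bound \<open>K\<close> below contradicts.\<close>
  have grow: "q ^ (2 ^ j) \<le> a (2 ^ j) / a 0" for j
  proof (induction j)
    case 0 then show ?case by (simp add: q_def)
  next
    case (Suc j)
    have "q ^ (2 ^ Suc j) = (q ^ (2 ^ j))\<^sup>2" by (simp add: power_mult[symmetric] mult.commute)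
    also have "\<dots> \<le> (a (2 ^ j) / a 0)\<^sup>2" using Suc q1 by (intro power_mono) auto
    also have "\<dots> \<le> a (2 ^ Suc j) / a 0"
      using conv[of "2 ^ j"] a0 by (simp add: power2_eq_square divide_simps mult.commute)
    finally show ?case .
  qed
  define K where "K = (\<Sum>i\<in>{0..<n}. (\<Sum>j\<in>{0..<n}. c * \<bar>x $ j\<bar>)\<^sup>2)"
  have bound: "a k \<le> K" for k
  proof -
    have "\<bar>B k $ i\<bar> \<le> (\<Sum>j\<in>{0..<n}. c * \<bar>x $ j\<bar>)" if "i < n" for i
    proof -
      have "B k $ i = (\<Sum>j\<in>{0..<n}. (A ^\<^sub>m k) $$ (i,j) * x $ j)"
        unfolding B_def using Ak[of k]
        by (rule mult_mat_vec_nth) (use that x in auto)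
      also have "\<bar>\<dots>\<bar> \<le> (\<Sum>j\<in>{0..<n}. \<bar>(A ^\<^sub>m k) $$ (i,j)\<bar> * \<bar>x $ j\<bar>)"
        using sum_abs[of "\<lambda>j. (A ^\<^sub>m k) $$ (i,j) * x $ j"] by (simp add: abs_mult)
      also have "\<dots> \<le> (\<Sum>j\<in>{0..<n}. c * \<bar>x $ j\<bar>)"
        using that c by (intro sum_mono mult_right_mono) auto
      finally show ?thesis .
    qed
    then have "(B k $ i)\<^sup>2 \<le> (\<Sum>j\<in>{0..<n}. c * \<bar>x $ j\<bar>)\<^sup>2" if "i < n" for i
      using that by (simp add: abs_le_square_iff[symmetric] order_trans[OF _ abs_ge_self])
    then have "(\<Sum>i\<in>{0..<n}. (B k $ i)\<^sup>2) \<le> K" unfolding K_def by (intro sum_mono) simp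
    moreover have "a k = (\<Sum>i\<in>{0..<n}. (B k $ i)\<^sup>2)"
      using Bk[of k] by (simp add: a_def scalar_prod_def power2_eq_square)
    ultimately show ?thesis by simp
  qed
  obtain j where j: "q ^ j > K / a 0" using real_arch_pow[OF q1] by blast
  have "q ^ j \<le> q ^ (2 ^ j)" using q1 by (intro power_increasing) (auto intro: less_imp_le)
  also have "\<dots> \<le> K / a 0" using grow[of j] bound[of "2 ^ j"] a0
    by (meson divide_right_mono less_imp_le order_trans)
  finally show False using j by simp
qed

text \<open>The contraction lemma wants eigenvalues strictly inside the unit interval. Dividing by
  any \<open>m > l\<close> achieves this, even for \<open>l = 0\<close>; the bound for
  \<open>l\<close> itself is the limit of \<open>m\<close> tending to \<open>l\<close> from
  above.\<close>

lemma symmetric_norm_bound: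
  fixes A :: "real mat"
  assumes A: "A \<in> carrier_mat n n" and sym: "transpose_mat A = A"
    and ev: "\<And>r. eigenvalue A r \<Longrightarrow> \<bar>r\<bar> \<le> l" and l: "l \<ge> 0" and x: "x \<in> carrier_vec n"
  shows "(A *\<^sub>v x) \<bullet> (A *\<^sub>v x) \<le> l\<^sup>2 * (x \<bullet> x)"
proof -
  have main: "(A *\<^sub>v x) \<bullet> (A *\<^sub>v x) \<le> m\<^sup>2 * (x \<bullet> x)" if m: "m > l" for m
  proof -
    let ?A = "(1 / m) \<cdot>\<^sub>m A"
    have m0: "m > 0" using m l by simp
    have "\<bar>r\<bar> < 1" if r: "eigenvalue ?A r" for r
    proof -
      obtain v where v: "v \<in> carrier_vec n" "v \<noteq> 0\<^sub>v n" "?A *\<^sub>v v = r \<cdot>\<^sub>v v"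
        using r A unfolding eigenvalue_def eigenvector_def by auto
      have "A *\<^sub>v v = (m * r) \<cdot>\<^sub>v v"
      proof (rule eq_vecI)
        fix i assume "i < dim_vec ((m * r) \<cdot>\<^sub>v v)"
        then have i: "i < n" using v by simp
        have "(?A *\<^sub>v v) $ i = r * v $ i" using v i by simp
        moreover have "(?A *\<^sub>v v) $ i = (1 / m) * (A *\<^sub>v v) $ i" using i A v(1) by simp
        ultimately have "(1 / m) * (A *\<^sub>v v) $ i = r * v $ i" by (simp only:)
        then show "(A *\<^sub>v v) $ i = ((m * r) \<cdot>\<^sub>v v) $ i" using i v m0 by (simp add: field_simps)
      qed (use A v in simp)
      then have "eigenvalue A (m * r)" unfolding eigenvalue_def eigenvector_def using v A by auto
      from ev[OF this] have "m * \<bar>r\<bar> < m * 1" using m m0 by (simp only: abs_mult)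
      then show ?thesis using m0 by (metis mult_less_cancel_left_pos)
    qed
    moreover have "transpose_mat ?A = ?A"
    proof (rule eq_matI)
      fix i j assume ij: "i < dim_row ?A" "j < dim_col ?A"
      have "transpose_mat A $$ (i,j) = A $$ (i,j)" using sym by simp
      then show "transpose_mat ?A $$ (i,j) = ?A $$ (i,j)" using ij A by simp
    qed (use A in auto)
    ultimately have "(?A *\<^sub>v x) \<bullet> (?A *\<^sub>v x) \<le> x \<bullet> x"
      using symmetric_contraction[of ?A n x] A x by simp
    moreover have "?A *\<^sub>v x = (1 / m) \<cdot>\<^sub>v (A *\<^sub>v x)" using A x by (intro eq_vecI) auto
    ultimately have "(1 / m) * ((1 / m) * ((A *\<^sub>v x) \<bullet> (A *\<^sub>v x))) \<le> x \<bullet> x" using A x by simp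
    then show ?thesis using m0 by (simp add: field_simps power2_eq_square)
  qed
  show ?thesis
  proof (rule tendsto_lowerbound)
    show "((\<lambda>m. m\<^sup>2 * (x \<bullet> x)) \<longlongrightarrow> l\<^sup>2 * (x \<bullet> x)) (at_right l)"
      by (intro tendsto_intros)
    show "eventually (\<lambda>m. (A *\<^sub>v x) \<bullet> (A *\<^sub>v x) \<le> m\<^sup>2 * (x \<bullet> x)) (at_right l)"
      using main by (auto simp: eventually_at_right_field intro!: exI[of _ "l + 1"])
  qed simp
qed

text \<open>In a Schur form with the eigenvalue first on the diagonal, back substitution leaves only the
  first coordinate free.\<close>
lemma simple_eigenvalue_eigenvectors:
  fixes A :: "real mat"
  assumes A: "A \<in> carrier_mat n n" and es: "char_poly A = (\<Prod>e\<leftarrow>r # es. [:- e, 1:])"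
    and simple: "r \<notin> set es"
    and u: "u \<in> carrier_vec n" "A *\<^sub>v u = r \<cdot>\<^sub>v u" "u \<noteq> 0\<^sub>v n"
    and v: "v \<in> carrier_vec n" "A *\<^sub>v v = r \<cdot>\<^sub>v v"
  shows "\<exists>c. v = c \<cdot>\<^sub>v u"
proof -
  obtain T P Q where "schur_decomposition A (r # es) = (T,P,Q)" by (metis prod_cases3)
  then have sim: "similar_mat_wit A T P Q" and ut: "upper_triangular T" and diag: "diag_mat T = r # es"
    using schur_decomposition[OF A es] by auto
  note wit = similar_mat_witD2[OF A sim]
  have len: "length es + 1 = n" using length_split[OF A es] by simp
  have T_diag: "T $$ (i,i) \<noteq> r" if "0 < i" "i < n" for i
  proof -
    have "T $$ (i,i) = (r # es) ! i" using that wit(5)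
      by (simp add: diag_mat_def flip: diag)
    also have "\<dots> \<in> set es" using that len by (cases i) auto
    finally show ?thesis using simple by auto
  qed
  \<comment> \<open>Induction from the last coordinate upwards: in row \<open>i\<close> of Tw = rw,
    the entries left of the diagonal vanish by triangularity and the coordinates to the right by
    induction. What remains is \<open>T $$ (i,i) * w $ i = r * w $ i\<close>, and the diagonal entry
    differs from \<open>r\<close>.\<close>
  have coord: "(Q *\<^sub>v x) $ i = 0"
    if x: "x \<in> carrier_vec n" "A *\<^sub>v x = r \<cdot>\<^sub>v x" and i: "0 < i" "i < n" for x i
    using i
  proof (induction "n - i" arbitrary: i rule: less_induct)
    case less
    let ?w = "Q *\<^sub>v x"
    have w: "?w \<in> carrier_vec n" using wit(7) x by simp
    have "Q * A = T * Q"
    proof -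
      have "Q * A = Q * (P * (T * Q))"
        using wit by (simp add: assoc_mult_mat[of _ n n _ n _ n])
      also have "\<dots> = (Q * P) * (T * Q)"
        using wit(5-7) by (simp add: assoc_mult_mat[of Q n n P n "T * Q" n])
      finally show ?thesis using wit(2,5,7) by simp
    qed
    then have "T *\<^sub>v ?w = Q *\<^sub>v (A *\<^sub>v x)"
      using assoc_mult_mat_vec[OF wit(7) A x(1)] assoc_mult_mat_vec[OF wit(5,7) x(1)] by simp
    also have "\<dots> = r \<cdot>\<^sub>v ?w" using x wit by (simp add: mult_mat_vec)
    finally have "(T *\<^sub>v ?w) $ i = r * ?w $ i" using less.prems w wit(7) by simp
    moreover have "(T *\<^sub>v ?w) $ i = (\<Sum>j\<in>{0..<n}. T $$ (i,j) * ?w $ j)"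
      using mult_mat_vec_nth[OF wit(5) w less.prems(2)] .
    moreover have "\<dots> = (\<Sum>j\<in>{0..<n}. if j = i then T $$ (i,i) * ?w $ i else 0)"
    proof (rule sum.cong)
      fix j assume j: "j \<in> {0..<n}"
      show "T $$ (i,j) * ?w $ j = (if j = i then T $$ (i,i) * ?w $ i else 0)"
      proof (cases j i rule: linorder_cases)
        case less' : less
        then show ?thesis using ut less.prems wit(5) by (simp add: upper_triangular_def)
      next
        case greater
        then have "?w $ j = 0" using less.hyps[of j] j less.prems by simp
        then show ?thesis using greater by simp
      qed simp
    qed simp
    ultimately have "T $$ (i,i) * ?w $ i = r * ?w $ i" using less.prems by simp
    then show ?case using T_diag[OF less.prems] by simp
  qed
  have PQ: "x = P *\<^sub>v (Q *\<^sub>v x)" if "x \<in> carrier_vec n" for x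
    using assoc_mult_mat_vec[OF wit(6,7) that] wit(1) that by simp
  have Qc: "Q *\<^sub>v x \<in> carrier_vec n" if "x \<in> carrier_vec n" for x using wit(7) that by simp
  have "(Q *\<^sub>v u) $ 0 \<noteq> 0"
  proof
    assume 0: "(Q *\<^sub>v u) $ 0 = 0"
    have "Q *\<^sub>v u = 0\<^sub>v n"
    proof (rule eq_vecI)
      fix i assume "i < dim_vec (0\<^sub>v n)"
      then show "(Q *\<^sub>v u) $ i = 0\<^sub>v n $ i" using coord[OF u(1,2), of i] 0 by (cases "i = 0") auto
    qed (use wit(7) in simp)
    then have "u = P *\<^sub>v 0\<^sub>v n" using PQ[OF u(1)] by simp
    also have "\<dots> = 0\<^sub>v n" using wit(6) by (intro eq_vecI) auto
    finally show False using u by simp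
  qed
  moreover define c where "c = (Q *\<^sub>v v) $ 0 / (Q *\<^sub>v u) $ 0"
  ultimately have c0: "(Q *\<^sub>v v) $ 0 = c * (Q *\<^sub>v u) $ 0" by simp
  have "Q *\<^sub>v v = c \<cdot>\<^sub>v (Q *\<^sub>v u)"
  proof (rule eq_vecI)
    fix i assume "i < dim_vec (c \<cdot>\<^sub>v (Q *\<^sub>v u))"
    then have i: "i < n" using wit(7) by simp
    have "(Q *\<^sub>v v) $ i = c * (Q *\<^sub>v u) $ i"
      using coord[OF u(1,2), of i] coord[OF v, of i] c0 i by (cases "i = 0") simp_all
    then show "(Q *\<^sub>v v) $ i = (c \<cdot>\<^sub>v (Q *\<^sub>v u)) $ i"
      using wit(7) i by simp
  qed (use wit(7) in simp)
  then have "v = c \<cdot>\<^sub>v u"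
    using PQ[OF u(1)] PQ[OF v(1)] mult_mat_vec[OF wit(6) Qc[OF u(1)]] by simp
  then show ?thesis ..
qed

section \<open>The spectrum of a regular graph and its deflation\<close>

lemma adj_matrix_carrier [simp]: "adj_matrix n E \<in> carrier_mat n n"
  by (simp add: adj_matrix_def)

lemma adj_matrix_sym: "graph_on n E \<Longrightarrow> transpose_mat (adj_matrix n E) = adj_matrix n E"
  by (rule eq_matI) (auto simp: adj_matrix_def graph_on_def)

lemma nbhd_subset: "graph_on n E \<Longrightarrow> nbhd E v \<subseteq> {0..<n}"
  by (auto simp: nbhd_def graph_on_def)

lemma adj_matrix_ones:
  assumes "regular_graph n d E"
  shows "adj_matrix n E *\<^sub>v vec n (\<lambda>_. 1) = real d \<cdot>\<^sub>v vec n (\<lambda>_. 1)"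
proof (rule eq_vecI)
  fix i assume "i < dim_vec (real d \<cdot>\<^sub>v vec n (\<lambda>_. 1))"
  then have i: "i < n" by simp
  have "(adj_matrix n E *\<^sub>v vec n (\<lambda>_. 1)) $ i = (\<Sum>j\<in>{0..<n}. if j \<in> nbhd E i then 1 else 0)"
    using i by (simp add: adj_matrix_def scalar_prod_def nbhd_def)
  also have "\<dots> = card ({0..<n} \<inter> nbhd E i)" by (simp add: sum.If_cases)
  also have "{0..<n} \<inter> nbhd E i = nbhd E i"
    using assms nbhd_subset unfolding regular_graph_def by blast
  finally show "(adj_matrix n E *\<^sub>v vec n (\<lambda>_. 1)) $ i = (real d \<cdot>\<^sub>v vec n (\<lambda>_. 1)) $ i"
    using assms i unfolding regular_graph_def by simp
qed (simp add: adj_matrix_def)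

lemma second_abs_eigenvalue_split:
  assumes g: "graph_on n E" and es: "char_poly (adj_matrix n E) = (\<Prod>e\<leftarrow>es. [:- e, 1:])"
  shows "second_abs_eigenvalue n E = sort (map abs es) ! (n - 2)"
proof -
  have "proots (\<Prod>e\<leftarrow>es. [:- e, 1:]) = mset es"
  proof (induction es)
    case (Cons e es)
    have "(\<Prod>e\<leftarrow>es. [:- e, 1:]) \<noteq> 0" by (auto simp: prod_list_zero_iff)
    then have "[:- e, 1:] * (\<Prod>e\<leftarrow>es. [:- e, 1:]) \<noteq> 0" by (intro no_zero_divisors) auto
    then show ?case using Cons
      by (simp add: proots_mult del: mult_pCons_left mult_eq_0_iff)
  qed simp
  then have "adj_eigenvalues n E = mset es"
    unfolding adj_eigenvalues_def es .
  then show ?thesis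
    unfolding second_abs_eigenvalue_def by (simp flip: mset_map)
qed

lemma second_abs_eigenvalue_nonneg:
  assumes "ndl_graph n d lam E" shows "lam \<ge> 0"
proof -
  from assms have g: "graph_on n E" and n: "n \<ge> 2" and le: "second_abs_eigenvalue n E \<le> lam"
    by (auto simp: ndl_graph_def regular_graph_def)
  obtain es where es: "char_poly (adj_matrix n E) = (\<Prod>e\<leftarrow>es. [:- e, 1:])"
    using symmetric_char_poly_splits[OF adj_matrix_carrier adj_matrix_sym[OF g]] by blast
  have "sort (map abs es) ! (n - 2) \<in> set (sort (map abs es))"
    using length_split[OF adj_matrix_carrier es] n by (intro nth_mem) simp
  then have "second_abs_eigenvalue n E \<ge> 0"
    by (auto simp: second_abs_eigenvalue_split[OF g es])
  with le show ?thesis by simp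
qed

text \<open>In the ascending list of absolute values, the bound on entry \<open>n - 2\<close> leaves
  only the last entry free to exceed \<open>lam\<close>. The all-ones vector makes \<open>d\<close>
  an eigenvalue, and \<open>d > lam\<close> makes it that entry. So \<open>d\<close> is a simple
  root and every other root is small.\<close>

lemma ndl_spectrum:
  assumes G: "ndl_graph n d lam E" and d: "real d > lam"
  obtains es where "char_poly (adj_matrix n E) = (\<Prod>e\<leftarrow>real d # es. [:- e, 1:])"
    "\<And>e. e \<in> set es \<Longrightarrow> \<bar>e\<bar> \<le> lam"
proof -
  from G have reg: "regular_graph n d E" and g: "graph_on n E" and n: "n \<ge> 2"
    and le: "second_abs_eigenvalue n E \<le> lam"
    by (auto simp: ndl_graph_def regular_graph_def)
  let ?A = "adj_matrix n E"
  obtain es where es: "char_poly ?A = (\<Prod>e\<leftarrow>es. [:- e, 1:])"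
    using symmetric_char_poly_splits[OF adj_matrix_carrier adj_matrix_sym[OF g]] by blast
  have len: "length es = n" using length_split[OF adj_matrix_carrier es] .
  have "eigenvalue ?A (real d)"
    unfolding eigenvalue_def eigenvector_def
    using adj_matrix_ones[OF reg] n
    by (intro exI[of _ "vec n (\<lambda>_. 1)"]) (auto simp: adj_matrix_def vec_eq_iff intro!: exI[of _ 0])
  then have d_in: "real d \<in> set es" using eigenvalue_in_split[OF adj_matrix_carrier es] by simp
  define es' where "es' = remove1 (real d) es"
  have ms: "mset es = mset (real d # es')" using d_in by (simp add: es'_def)
  have "(\<Prod>e\<leftarrow>es. [:- e, 1:]) = prod_mset (image_mset (\<lambda>e. [:- e, 1:]) (mset es))"
    by (simp flip: mset_map add: prod_mset_prod_list)
  also have "\<dots> = (\<Prod>e\<leftarrow>real d # es'. [:- e, 1:])"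
    unfolding ms by (simp flip: mset_map add: prod_mset_prod_list)
  finally have 1: "char_poly ?A = (\<Prod>e\<leftarrow>real d # es'. [:- e, 1:])" using es by simp
  define xs where "xs = sort (map abs es)"
  have lx: "length xs = n" and sx: "sorted xs" by (simp_all add: xs_def len)
  have "xs ! i \<le> lam" if "i < n - 1" for i
  proof -
    have "xs ! i \<le> xs ! (n - 2)" using that sx lx by (intro sorted_nth_mono) auto
    then show ?thesis using le second_abs_eigenvalue_split[OF g es] by (simp add: xs_def)
  qed
  then have "filter (\<lambda>x. x > lam) (take (n - 1) xs) = []"
    by (auto simp: filter_empty_conv in_set_conv_nth not_less)
  moreover have "length (filter (\<lambda>x. x > lam) (drop (n - 1) xs)) \<le> 1"
    using length_filter_le[of "\<lambda>x. x > lam" "drop (n - 1) xs"] lx by simp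
  ultimately have "length (filter (\<lambda>x. x > lam) xs) \<le> 1"
    by (metis append_take_drop_id filter_append append_Nil)
  moreover have "length (filter (\<lambda>x. x > lam) xs) = size (filter_mset (\<lambda>x. x > lam) (mset xs))"
    by (metis mset_filter size_mset)
  moreover have "mset xs = image_mset abs (mset es)" by (simp add: xs_def)
  ultimately have sz: "size (filter_mset (\<lambda>x. x > lam) (image_mset abs (mset (real d # es')))) \<le> 1"
    using ms by simp
  have "\<bar>e\<bar> \<le> lam" if e: "e \<in> set es'" for e
  proof (rule ccontr)
    assume "\<not> ?thesis"
    then have "\<bar>e\<bar> \<in># filter_mset (\<lambda>x. x > lam) (image_mset abs (mset es'))" using e by auto
    then have "size (filter_mset (\<lambda>x. x > lam) (image_mset abs (mset es'))) \<noteq> 0"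
      by (metis empty_not_add_mset multi_member_split size_eq_0_iff_empty)
    then show False using sz d by simp
  qed
  with 1 that show thesis by blast
qed

text \<open>Subtracting $d/n$ from every entry replaces the eigenvalue $d$ of the all-ones vector by $0$.\<close>
definition deflated_adj_matrix :: "nat \<Rightarrow> nat \<Rightarrow> (nat \<Rightarrow> nat \<Rightarrow> bool) \<Rightarrow> real mat" where
  "deflated_adj_matrix n d E = mat n n (\<lambda>(i,j). (if E i j then 1 else 0) - real d / real n)"

lemma deflated_adj_matrix_carrier [simp]: "deflated_adj_matrix n d E \<in> carrier_mat n n"
  by (simp add: deflated_adj_matrix_def)

lemma deflated_adj_matrix_sym:
  "graph_on n E \<Longrightarrow> transpose_mat (deflated_adj_matrix n d E) = deflated_adj_matrix n d E"
  by (rule eq_matI) (auto simp: deflated_adj_matrix_def graph_on_def)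

lemma deflated_adj_matrix_mult:
  assumes x: "x \<in> carrier_vec n"
  shows "deflated_adj_matrix n d E *\<^sub>v x
    = adj_matrix n E *\<^sub>v x - (real d / real n * (vec n (\<lambda>_. 1) \<bullet> x)) \<cdot>\<^sub>v vec n (\<lambda>_. 1)"
  using x
  by (intro eq_vecI)
    (auto simp: deflated_adj_matrix_def adj_matrix_def scalar_prod_def left_diff_distrib sum_subtractf
      sum_distrib_left)

text \<open>The deflated matrix kills the all-ones vector, so by symmetry an eigenvector for
  \<open>r \<noteq> 0\<close> is orthogonal to it. On such vectors deflation changes nothing and
  \<open>r\<close> is an eigenvalue of the adjacency matrix. It is not \<open>d\<close>: simplicity
  would make the eigenvector a multiple of the all-ones vector, hence zero.\<close>

lemma deflated_eigenvalue_bound: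
  assumes G: "ndl_graph n d lam E" and d: "real d > lam"
    and ev: "eigenvalue (deflated_adj_matrix n d E) r"
  shows "\<bar>r\<bar> \<le> lam"
proof -
  let ?A = "adj_matrix n E" and ?B = "deflated_adj_matrix n d E" and ?one = "vec n (\<lambda>_. 1) :: real vec"
  from G have reg: "regular_graph n d E" and g: "graph_on n E" and n: "n \<ge> 2"
    by (auto simp: ndl_graph_def regular_graph_def)
  obtain es where es: "char_poly ?A = (\<Prod>e\<leftarrow>real d # es. [:- e, 1:])"
    and small: "\<And>e. e \<in> set es \<Longrightarrow> \<bar>e\<bar> \<le> lam"
    using ndl_spectrum[OF G d] by blast
  obtain v where v: "v \<in> carrier_vec n" "v \<noteq> 0\<^sub>v n" "?B *\<^sub>v v = r \<cdot>\<^sub>v v"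
    using ev unfolding eigenvalue_def eigenvector_def by (auto simp: deflated_adj_matrix_def)
  have one: "?one \<in> carrier_vec n" by simp
  have one_one: "?one \<bullet> ?one = real n" by (simp add: scalar_prod_def)
  have B1: "?B *\<^sub>v ?one = 0\<^sub>v n"
    using n by (auto simp: deflated_adj_matrix_mult[OF one] adj_matrix_ones[OF reg] one_one)
  have "r * (?one \<bullet> v) = ?one \<bullet> (?B *\<^sub>v v)" using v one by simp
  also have "\<dots> = (?B *\<^sub>v ?one) \<bullet> v"
    using sym_scalar_prod[OF deflated_adj_matrix_carrier deflated_adj_matrix_sym[OF g] one v(1)] by simp
  also have "\<dots> = 0" using B1 v by simp
  finally have "r = 0 \<or> ?one \<bullet> v = 0" by simp
  then show ?thesis
  proof
    assume "r = 0" then show ?thesis using second_abs_eigenvalue_nonneg[OF G] by simp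
  next
    assume ov: "?one \<bullet> v = 0"
    then have "?B *\<^sub>v v = ?A *\<^sub>v v - 0 \<cdot>\<^sub>v ?one" using deflated_adj_matrix_mult[OF v(1)] by simp
    also have "\<dots> = ?A *\<^sub>v v" by (intro eq_vecI) (auto simp: adj_matrix_def)
    finally have Av: "?A *\<^sub>v v = r \<cdot>\<^sub>v v" using v by simp
    have "r \<in> set (real d # es)"
      using Av v eigenvalue_in_split[OF adj_matrix_carrier es]
      unfolding eigenvalue_def eigenvector_def by (auto simp: adj_matrix_def)
    moreover have "r \<noteq> real d"
    proof
      assume rd: "r = real d"
      have "real d \<notin> set es" using small d by force
      moreover have "?one \<noteq> 0\<^sub>v n" using n by (auto simp: vec_eq_iff intro!: exI[of _ 0])
      ultimately obtain c where c: "v = c \<cdot>\<^sub>v ?one"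
        using simple_eigenvalue_eigenvectors[OF adj_matrix_carrier es _ one adj_matrix_ones[OF reg] _ v(1)]
          Av rd by blast
      then have "c * real n = 0" using ov one_one by simp
      then have "v = 0\<^sub>v n" using n c by (auto simp: vec_eq_iff)
      then show False using v by simp
    qed
    ultimately show ?thesis using small by auto
  qed
qed

text \<open>Counts ordered pairs: an edge inside \<open>S \<inter> T\<close> contributes twice. With
  this convention the count is exactly the bilinear form of the adjacency matrix on indicator
  vectors, also for overlapping sets.\<close>

definition edge_count :: "(nat \<Rightarrow> nat \<Rightarrow> bool) \<Rightarrow> nat set \<Rightarrow> nat set \<Rightarrow> nat" where
  "edge_count E S T = (\<Sum>v\<in>S. card (nbhd E v \<inter> T))"

text \<open>The deviation from the expected count is the bilinear form of the deflated matrix on the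
  two indicator vectors. Cauchy--Schwarz and the norm bound \<open>lam\<close> finish, since an
  indicator vector has squared norm equal to the cardinality.\<close>

theorem expander_mixing:
  assumes G: "ndl_graph n d lam E" and d: "real d > lam" and S: "S \<subseteq> {0..<n}" and T: "T \<subseteq> {0..<n}"
  shows "\<bar>real (edge_count E S T) - real d * real (card S) * real (card T) / real n\<bar>
    \<le> lam * sqrt (real (card S) * real (card T))"
proof -
  let ?A = "adj_matrix n E" and ?B = "deflated_adj_matrix n d E" and ?one = "vec n (\<lambda>_. 1) :: real vec"
  from G have g: "graph_on n E" by (auto simp: ndl_graph_def regular_graph_def)
  define f :: "nat set \<Rightarrow> real vec" where "f X = vec n (\<lambda>i. if i \<in> X then 1 else 0)" for X
  have f: "f X \<in> carrier_vec n" for X by (simp add: f_def)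
  have sum_f: "(\<Sum>i\<in>{0..<n}. if i \<in> X then h i else 0) = sum h X" if "X \<subseteq> {0..<n}" for X and h :: "nat \<Rightarrow> real"
    using that by (simp add: sum.If_cases Int_absorb1)
  have ff: "f X \<bullet> f X = real (card X)" if "X \<subseteq> {0..<n}" for X
    using sum_f[OF that, of "\<lambda>_. 1"] by (simp add: f_def scalar_prod_def if_distrib cong: if_cong)
  have one_f: "?one \<bullet> f X = real (card X)" if "X \<subseteq> {0..<n}" for X
    using sum_f[OF that, of "\<lambda>_. 1"] by (simp add: f_def scalar_prod_def)
  have f_one: "f X \<bullet> ?one = real (card X)" if "X \<subseteq> {0..<n}" for X
    using one_f[OF that] comm_scalar_prod[OF f, of ?one X] by simp
  have row: "(?A *\<^sub>v f T) $ i = real (card (nbhd E i \<inter> T))" if "i < n" for i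
  proof -
    have "(?A *\<^sub>v f T) $ i = (\<Sum>j\<in>{0..<n}. if j \<in> nbhd E i \<inter> T then 1 else 0)"
      using that by (auto simp: adj_matrix_def f_def scalar_prod_def nbhd_def intro!: sum.cong)
    also have "\<dots> = real (card (nbhd E i \<inter> T))"
      using sum_f[of "nbhd E i \<inter> T" "\<lambda>_. 1"] T by auto
    finally show ?thesis .
  qed
  have Af: "?A *\<^sub>v f T \<in> carrier_vec n" by (rule mult_mat_vec_carrier[OF adj_matrix_carrier f])
  have "f S \<bullet> (?A *\<^sub>v f T) = (\<Sum>i\<in>{0..<n}. if i \<in> S then real (card (nbhd E i \<inter> T)) else 0)"
    using Af row unfolding scalar_prod_def carrier_vecD[OF Af] by (intro sum.cong) (auto simp: f_def)
  also have "\<dots> = real (edge_count E S T)" using sum_f[OF S] by (simp add: edge_count_def)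
  finally have eq: "f S \<bullet> (?B *\<^sub>v f T) = real (edge_count E S T) - real d * real (card S) * real (card T) / real n"
    using f[of S] Af S T
    by (simp add: deflated_adj_matrix_mult[OF f] scalar_prod_minus_distrib[of _ n] one_f f_one)
  have "(f S \<bullet> (?B *\<^sub>v f T))\<^sup>2 \<le> (f S \<bullet> f S) * ((?B *\<^sub>v f T) \<bullet> (?B *\<^sub>v f T))"
    by (rule sq_scalar_prod_le[OF f mult_mat_vec_carrier[OF deflated_adj_matrix_carrier f]])
  also have "\<dots> \<le> (f S \<bullet> f S) * (lam\<^sup>2 * (f T \<bullet> f T))"
    using deflated_eigenvalue_bound[OF G d] second_abs_eigenvalue_nonneg[OF G] f
      deflated_adj_matrix_sym[OF g]
    by (intro mult_left_mono[OF symmetric_norm_bound[of ?B n lam "f T"]] scalar_prod_self_nonneg) simp_all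
  also have "\<dots> = (lam * sqrt (real (card S) * real (card T)))\<^sup>2"
    using S T by (simp add: ff power_mult_distrib)
  finally have "(real (edge_count E S T) - real d * real (card S) * real (card T) / real n)\<^sup>2
      \<le> (lam * sqrt (real (card S) * real (card T)))\<^sup>2"
    unfolding eq .
  moreover have "lam * sqrt (real (card S) * real (card T)) \<ge> 0"
    using second_abs_eigenvalue_nonneg[OF G] by simp
  ultimately show ?thesis by (metis abs_le_square_iff abs_of_nonneg)
qed

section \<open>Friedman--Pippenger extendability\<close>

text \<open>Every vertex demands two pairs, and a pair already in use counts only for its parent. This makes
  Friedman--Pippenger extendability a Hall-type condition that is monotone under forgetting
  assignments.\<close>
definition avail :: "('a \<Rightarrow> 'b set) \<Rightarrow> ('b \<Rightarrow> 'a option) \<Rightarrow> 'a \<Rightarrow> 'b set" where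
  "avail F par w = {p \<in> F w. par p = None \<or> par p = Some w}"

text \<open>The range reaches \<open>2 * s\<close> rather than \<open>s\<close> so that the union of
  two sets smaller than \<open>s\<close> is still covered; the union argument for tight sets depends
  on it.\<close>

definition extendable :: "'a set \<Rightarrow> nat \<Rightarrow> ('a \<Rightarrow> 'b set) \<Rightarrow> ('b \<Rightarrow> 'a option) \<Rightarrow> bool" where
  "extendable W s F par \<longleftrightarrow>
    (\<forall>X\<subseteq>W. card X \<le> 2 * s \<longrightarrow> 2 * card X \<le> card (\<Union>w\<in>X. avail F par w))"

text \<open>Forgetting assignments only enlarges the sets \<open>avail\<close>. This is what makes
  rollback free of charge.\<close>

lemma extendable_mono:
  assumes fin: "finite W" "\<And>w. w \<in> W \<Longrightarrow> finite (F w)"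
    and ext: "extendable W s F par'" and le: "par \<subseteq>\<^sub>m par'"
  shows "extendable W s F par"
  unfolding extendable_def
proof (intro allI impI)
  fix X assume X: "X \<subseteq> W" "card X \<le> 2 * s"
  have "avail F par' w \<subseteq> avail F par w" for w
    using le by (auto simp: avail_def map_le_def dom_def)
  moreover have "finite (\<Union>w\<in>X. avail F par w)"
    using X fin by (auto simp: avail_def intro: finite_subset)
  ultimately have "card (\<Union>w\<in>X. avail F par' w) \<le> card (\<Union>w\<in>X. avail F par w)"
    by (intro card_mono) auto
  then show "2 * card X \<le> card (\<Union>w\<in>X. avail F par w)"
    using ext X unfolding extendable_def by (meson order_trans)
qed

text \<open>The Friedman--Pippenger argument: if no child could be added, every candidate would be
  blocked by a tight set, tight sets are closed under union by submodularity, and the union of the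
  blocking sets together with $x$ would violate extendability.\<close>
lemma extendable_add_child:
  assumes fin: "finite W" "\<And>w. w \<in> W \<Longrightarrow> finite (F w)" and s: "s \<ge> 1"
    and ext: "extendable W s F par"
    and big: "\<And>X. X \<subseteq> W \<Longrightarrow> s \<le> card X \<Longrightarrow> card X \<le> 2 * s \<Longrightarrow>
      2 * card X < card (\<Union>w\<in>X. avail F par w)"
    and x: "x \<in> W" "card {p \<in> F x. par p = Some x} < 2"
  shows "\<exists>p\<in>F x. par p = None \<and> extendable W s F (par(p \<mapsto> x))"
proof (rule ccontr)
  assume neg: "\<not> ?thesis"
  define N where "N X = (\<Union>w\<in>X. avail F par w)" for X
  define tight where "tight X \<longleftrightarrow> X \<subseteq> W \<and> card X < s \<and> card (N X) = 2 * card X" for X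
  define A where "A = {p \<in> F x. par p = None}"
  have finN: "finite (N X)" if "X \<subseteq> W" for X
    using that fin unfolding N_def by (auto simp: avail_def intro: finite_subset)
  have lower: "2 * card X \<le> card (N X)" if "X \<subseteq> W" "card X \<le> 2 * s" for X
    using ext that unfolding extendable_def N_def by blast
  \<comment> \<open>By \<open>big\<close>, no set of size between \<open>s\<close> and
    \<open>2 * s\<close> is tight. So tightness, once known up to size \<open>2 * s\<close>, forces
    size below \<open>s\<close>, and unions can be iterated without the sizes growing.\<close>
  have tightI: "tight X" if "X \<subseteq> W" "card X \<le> 2 * s" "card (N X) \<le> 2 * card X" for X
  proof -
    have "\<not> s \<le> card X" using big[OF that(1)] that(2,3) unfolding N_def by linarith
    then show ?thesis unfolding tight_def using that lower[OF that(1,2)] by linarith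
  qed
  \<comment> \<open>Giving \<open>p\<close> to \<open>x\<close> can remove only \<open>p\<close>
    from the available pairs of a set, and only if the set does not contain \<open>x\<close>. A
    violated set had at least twice its size before and lost one pair, so it was tight.\<close>
  have block: "\<exists>X. tight X \<and> x \<notin> X \<and> p \<in> N X" if p: "p \<in> A" for p
  proof -
    have "\<not> extendable W s F (par(p \<mapsto> x))" using neg p unfolding A_def by blast
    then obtain X where X: "X \<subseteq> W" "card X \<le> 2 * s"
      and lt: "card (\<Union>w\<in>X. avail F (par(p \<mapsto> x)) w) < 2 * card X"
      by (auto simp: extendable_def not_le)
    let ?N' = "\<Union>w\<in>X. avail F (par(p \<mapsto> x)) w"
    have fin': "finite ?N'" using X fin by (auto simp: avail_def intro: finite_subset)
    have "\<not> N X \<subseteq> ?N'"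
      using card_mono[OF fin', of "N X"] lower[OF X] lt by linarith
    then have xX: "x \<notin> X" and pN: "p \<in> N X"
      using p unfolding N_def A_def avail_def by (auto split: if_splits)
    have "N X - {p} \<subseteq> ?N'" unfolding N_def avail_def by auto
    then have "card (N X - {p}) < 2 * card X" using card_mono[OF fin'] lt by (meson le_less_trans)
    then have "card (N X) \<le> 2 * card X" using pN finN[OF X(1)] by (simp add: card_Diff_singleton)
    then show ?thesis using tightI X xX pN by blast
  qed
  then obtain Z where Z: "\<And>p. p \<in> A \<Longrightarrow> tight (Z p) \<and> x \<notin> Z p \<and> p \<in> N (Z p)" by metis
  have un: "tight (X \<union> Y)" if X: "tight X" and Y: "tight Y" for X Y
  proof (rule tightI)
    have finXY: "finite X" "finite Y" using X Y fin(1) unfolding tight_def by (auto intro: finite_subset)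
    have fN: "finite (N X)" "finite (N Y)" using X Y finN unfolding tight_def by auto
    have XY: "card (X \<union> Y) + card (X \<inter> Y) = card X + card Y" using card_Un_Int[OF finXY] by simp
    show "X \<union> Y \<subseteq> W" using X Y unfolding tight_def by blast
    show "card (X \<union> Y) \<le> 2 * s" using XY X Y unfolding tight_def by linarith
    have "X \<inter> Y \<subseteq> W" "card (X \<inter> Y) \<le> 2 * s"
      using X card_mono[OF finXY(1), of "X \<inter> Y"] unfolding tight_def by auto
    then have "2 * card (X \<inter> Y) \<le> card (N (X \<inter> Y))" by (rule lower)
    also have "\<dots> \<le> card (N X \<inter> N Y)" using fN by (intro card_mono) (auto simp: N_def)
    finally have "2 * card (X \<inter> Y) \<le> card (N X \<inter> N Y)" .
    moreover have "card (N (X \<union> Y)) + card (N X \<inter> N Y) = card (N X) + card (N Y)"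
      using card_Un_Int[OF fN] by (simp add: N_def)
    ultimately show "card (N (X \<union> Y)) \<le> 2 * card (X \<union> Y)"
      using XY X Y unfolding tight_def by linarith
  qed
  have "finite A" unfolding A_def using fin x by simp
  moreover have "tight (\<Union>p\<in>A'. Z p)" if "finite A'" "A' \<subseteq> A" for A'
    using that
  proof (induction A' rule: finite_induct)
    \<comment> \<open>The empty set counts as tight because \<open>0 < s\<close>; it is the blocking
      union when \<open>x\<close> has no free pair at all.\<close>
    case empty
    then show ?case using s by (simp add: tight_def N_def)
  next
    case (insert p A')
    then show ?case using un Z by simp
  qed
  ultimately have tU: "tight (\<Union>p\<in>A. Z p)" by simp
  define U where "U = (\<Union>p\<in>A. Z p)"
  note tU = tU[folded U_def]
  have finU: "finite U" using tU fin(1) unfolding tight_def by (auto intro: finite_subset)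
  have cU: "card (insert x U) = card U + 1"
    using finU Z unfolding U_def by simp
  have fc: "finite {p \<in> F x. par p = Some x}" using fin x by simp
  \<comment> \<open>Every free pair of \<open>x\<close> already lies in \<open>N U\<close>, so
    adding \<open>x\<close> to \<open>U\<close> brings in only its present children, at most one.
    Extendability would demand two.\<close>
  have "N (insert x U) \<subseteq> {p \<in> F x. par p = Some x} \<union> N U"
    using Z unfolding N_def U_def A_def avail_def by fastforce
  then have "card (N (insert x U)) \<le> card ({p \<in> F x. par p = Some x} \<union> N U)"
    using finN tU fc unfolding tight_def by (intro card_mono) auto
  also have "\<dots> \<le> card {p \<in> F x. par p = Some x} + card (N U)" by (rule card_Un_le)
  also have "\<dots> < 2 * card (insert x U)" using x tU cU unfolding tight_def by simp
  finally show False
    using lower[of "insert x U"] cU tU x s unfolding tight_def by auto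
qed

section \<open>Alternating paths as lists of traversed pairs\<close>

definition pair_of :: "'a \<times> 'a \<Rightarrow> 'a set" where
  "pair_of e = {fst e, snd e}"

text \<open>In the following lists each entry $(x,z)$ traverses the pair $\{x,z\}$ from $x$ to $z$;
  the steps between consecutive entries are edges of $E$. A walk ends right after a pair,
  an alternating connection ends with an edge.\<close>
fun walk :: "('a \<Rightarrow> 'a \<Rightarrow> bool) \<Rightarrow> 'a \<Rightarrow> ('a \<times> 'a) list \<Rightarrow> 'a \<Rightarrow> bool" where
  "walk E v [] y \<longleftrightarrow> v = y"
| "walk E v ((x,z) # ps) y \<longleftrightarrow> E v x \<and> walk E z ps y"

fun connection :: "('a \<Rightarrow> 'a \<Rightarrow> bool) \<Rightarrow> 'a \<Rightarrow> ('a \<times> 'a) list \<Rightarrow> 'a \<Rightarrow> bool" where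
  "connection E v [] b \<longleftrightarrow> E v b"
| "connection E v ((x,z) # ps) b \<longleftrightarrow> E v x \<and> connection E z ps b"

lemma connection_append: "walk E a ps y \<Longrightarrow> connection E y qs b \<Longrightarrow> connection E a (ps @ qs) b"
  by (induction E a ps y rule: walk.induct) auto

lemma connection_snoc: "connection E a (ps @ [(x,z)]) b \<longleftrightarrow> connection E a ps x \<and> E z b"
  by (induction E a ps b rule: connection.induct) auto

lemma connection_rev:
  assumes "\<And>u v. E u v \<Longrightarrow> E v u" "connection E a ps b"
  shows "connection E b (map prod.swap (rev ps)) a"
  using assms(2)
proof (induction ps arbitrary: a)
  case (Cons p ps)
  then show ?case using assms(1) by (cases p) (auto simp: connection_snoc)
qed (use assms(1) in auto)

text \<open>Translates a list of pairs into the list of graph edges that \<open>alt_path\<close>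
  expects. The edges surround the pairs, so there is one more edge than pairs, and the empty list
  stands for a single edge.\<close>

fun edges_of :: "'a \<Rightarrow> ('a \<times> 'a) list \<Rightarrow> 'a \<Rightarrow> ('a \<times> 'a) list" where
  "edges_of v [] b = [(v,b)]"
| "edges_of v ((x,z) # ps) b = (v,x) # edges_of z ps b"

lemma edges_of_not_Nil [simp]: "edges_of v ps b \<noteq> []"
  by (cases "(v, ps, b)" rule: edges_of.cases) auto

lemma fst_hd_edges_of [simp]: "fst (hd (edges_of v ps b)) = v"
  by (cases "(v, ps, b)" rule: edges_of.cases) auto

lemma snd_last_edges_of [simp]: "snd (last (edges_of v ps b)) = b"
  by (induction v ps b rule: edges_of.induct) auto

lemma edges_of_connection: "connection E v ps b \<Longrightarrow> (u,w) \<in> set (edges_of v ps b) \<Longrightarrow> E u w"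
  by (induction v ps b rule: edges_of.induct) auto

lemma edges_of_pairs:
  assumes "Suc i < length (edges_of v ps b)"
  shows "{snd (edges_of v ps b ! i), fst (edges_of v ps b ! Suc i)} \<in> pair_of ` set ps"
  using assms
proof (induction v ps b arbitrary: i rule: edges_of.induct)
  case (2 v x z ps b)
  show ?case
  proof (cases i)
    case 0
    have "fst (edges_of z ps b ! 0) = z"
      using fst_hd_edges_of[of z ps b] by (simp only: hd_conv_nth edges_of_not_Nil not_False_eq_True)
    then show ?thesis using 0 by (simp add: pair_of_def)
  next
    case (Suc j)
    then show ?thesis using 2 by auto
  qed
qed simp

text \<open>Regroups the vertex sequence from edges to pairs. Repetition of vertices thereby becomes
  a question about disjointness of pairs.\<close>

lemma concat_edges_of:
  "concat (map (\<lambda>(u,w). [u,w]) (edges_of v ps b)) = v # concat (map (\<lambda>(x,z). [x,z]) ps) @ [b]"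
  by (induction v ps b rule: edges_of.induct) auto

lemma set_concat_pairs: "set (concat (map (\<lambda>(x,z). [x,z]) ps)) = \<Union>(pair_of ` set ps)"
  by (induction ps) (auto simp: pair_of_def)

lemma remdups_adj_Cons_notin: "x \<notin> set xs \<Longrightarrow> remdups_adj (x # xs) = x # remdups_adj xs"
  by (cases xs) auto

text \<open>Different pairs are disjoint, so a vertex can recur only inside one entry
  \<open>(x,x)\<close>. Its two copies are adjacent and \<open>remdups_adj\<close> merges them,
  which handles the singleton pairs.\<close>

lemma distinct_remdups_adj_pairs:
  assumes "distinct (map pair_of ps)" "b \<notin> \<Union>(pair_of ` set ps)"
    "\<And>p q. p \<in> pair_of ` set ps \<Longrightarrow> q \<in> pair_of ` set ps \<Longrightarrow> p \<noteq> q \<Longrightarrow> p \<inter> q = {}"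
  shows "distinct (remdups_adj (concat (map (\<lambda>(x,z). [x,z]) ps) @ [b]))"
  using assms
proof (induction ps)
  case (Cons e ps)
  obtain x z where e: "e = (x,z)" by (cases e)
  let ?r = "concat (map (\<lambda>(x,z). [x,z]) ps) @ [b]"
  have IH: "distinct (remdups_adj ?r)" using Cons by simp
  have "pair_of e \<inter> q = {}" if "q \<in> pair_of ` set ps" for q
    using Cons.prems(1) that by (intro Cons.prems(3)) auto
  then have "pair_of e \<inter> \<Union>(pair_of ` set ps) = {}" by blast
  then have "x \<notin> set ?r" "z \<notin> set ?r"
    using Cons.prems(2) unfolding set_append set_concat_pairs e pair_of_def by auto
  then show ?case using IH by (cases "x = z") (auto simp: e remdups_adj_Cons_notin)
qed simp

text \<open>The exact vertex set in the second claim serves to separate the paths of different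
  endpoint pairs.\<close>

lemma alt_path_edges_of:
  assumes conn: "connection E a ps b" and dist: "distinct (map pair_of ps)"
    and M: "pair_of ` set ps \<subseteq> M" "\<And>p q. p \<in> M \<Longrightarrow> q \<in> M \<Longrightarrow> p \<noteq> q \<Longrightarrow> p \<inter> q = {}"
    and ab: "a \<noteq> b" "a \<notin> \<Union>M" "b \<notin> \<Union>M"
  shows "alt_path E M a b (edges_of a ps b)"
    and "set (path_verts (edges_of a ps b)) = {a,b} \<union> \<Union>(pair_of ` set ps)"
proof -
  let ?r = "concat (map (\<lambda>(x,z). [x,z]) ps) @ [b]"
  have "distinct (remdups_adj ?r)"
  proof (rule distinct_remdups_adj_pairs[OF dist])
    show "b \<notin> \<Union>(pair_of ` set ps)" using ab(3) M(1) by blast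
    show "p \<inter> q = {}" if "p \<in> pair_of ` set ps" "q \<in> pair_of ` set ps" "p \<noteq> q" for p q
      using that M(1) by (intro M(2)) auto
  qed
  moreover have "a \<notin> set ?r"
    using ab(1,2) M(1) unfolding set_append set_concat_pairs by auto
  ultimately have "distinct (path_verts (edges_of a ps b))"
    unfolding path_verts_def concat_edges_of by (simp add: remdups_adj_Cons_notin)
  moreover have "\<forall>i. Suc i < length (edges_of a ps b) \<longrightarrow>
      {snd (edges_of a ps b ! i), fst (edges_of a ps b ! Suc i)} \<in> M"
    using edges_of_pairs M(1) by (metis subsetD)
  ultimately show "alt_path E M a b (edges_of a ps b)"
    unfolding alt_path_def using edges_of_connection[OF conn] by auto
  show "set (path_verts (edges_of a ps b)) = {a,b} \<union> \<Union>(pair_of ` set ps)"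
    unfolding path_verts_def concat_edges_of remdups_adj_set
    using set_concat_pairs[of ps] by auto
qed

section \<open>Routing through trees of pairs\<close>

text \<open>\<open>D\<close> holds the pairs the path may use and \<open>k\<close> bounds their
  number. The last conjunct says that the path contains the parents of its own pairs, so keeping
  just these pairs in a rollback leaves no parent outside the path.\<close>

definition reaches ::
  "('a \<Rightarrow> 'a \<Rightarrow> bool) \<Rightarrow> ('a set \<Rightarrow> 'a option) \<Rightarrow> 'a set set \<Rightarrow> nat \<Rightarrow> 'a \<Rightarrow> 'a \<Rightarrow> bool" where
  "reaches E par D k v y \<longleftrightarrow> (\<exists>ps. walk E v ps y \<and> distinct (map pair_of ps) \<and>
    pair_of ` set ps \<subseteq> D \<and> length ps \<le> k \<and>
    (\<forall>q\<in>pair_of ` set ps. \<exists>w\<in>insert v (\<Union>(pair_of ` set ps)). par q = Some w))"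

lemma reaches_mono:
  assumes "reaches E par D k v y" "par \<subseteq>\<^sub>m par'" "D \<subseteq> D'" "D \<subseteq> dom par"
  shows "reaches E par' D' k v y"
proof -
  from assms(1) obtain ps where ps: "walk E v ps y" "distinct (map pair_of ps)"
    "pair_of ` set ps \<subseteq> D" "length ps \<le> k"
    "\<forall>q\<in>pair_of ` set ps. \<exists>w\<in>insert v (\<Union>(pair_of ` set ps)). par q = Some w"
    unfolding reaches_def by blast
  have "par' q = par q" if "q \<in> pair_of ` set ps" for q
  proof -
    have "q \<in> dom par" using that ps(3) assms(4) by blast
    then show ?thesis using assms(2) by (auto simp: map_le_def)
  qed
  then have "\<forall>q\<in>pair_of ` set ps. \<exists>w\<in>insert v (\<Union>(pair_of ` set ps)). par' q = Some w"
    using ps(5) by metis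
  then show ?thesis unfolding reaches_def using ps(1-4) assms(3) by blast
qed

lemma reaches_Cons:
  assumes "reaches E par D k z y" "E v u" "{u,z} \<notin> D" "par {u,z} = Some v"
  shows "reaches E par (insert {u,z} D) (Suc k) v y"
proof -
  from assms(1) obtain ps where ps: "walk E z ps y" "distinct (map pair_of ps)"
    "pair_of ` set ps \<subseteq> D" "length ps \<le> k"
    and par: "\<forall>q\<in>pair_of ` set ps. \<exists>w\<in>insert z (\<Union>(pair_of ` set ps)). par q = Some w"
    unfolding reaches_def by blast
  have "\<exists>w\<in>insert v (\<Union>(pair_of ` set ((u,z) # ps))). par q = Some w"
    if "q \<in> pair_of ` set ((u,z) # ps)" for q
  proof (cases "q = {u,z}")
    case False
    then have "q \<in> pair_of ` set ps" using that by (auto simp: pair_of_def)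
    from par[rule_format, OF this] show ?thesis by (auto simp: pair_of_def)
  qed (use assms(4) in auto)
  moreover have "{u,z} \<notin> pair_of ` set ps" using ps(3) assms(3) by blast
  then have "distinct (map pair_of ((u,z) # ps))" using ps(2) by (simp add: pair_of_def)
  moreover have "pair_of ` set ((u,z) # ps) \<subseteq> insert {u,z} D" using ps(3) by (auto simp: pair_of_def)
  ultimately show ?thesis
    unfolding reaches_def using ps(1,4) assms(2) by (intro exI[of _ "(u,z) # ps"]) simp
qed

lemma ran_map_upd_subset: "ran (par(p \<mapsto> x)) \<subseteq> insert x (ran par)"
  by (auto simp: ran_def)

lemma map_upd_le: "par p = None \<Longrightarrow> par \<subseteq>\<^sub>m par(p \<mapsto> x)"
  by (auto simp: map_le_def)

text \<open>Collects what routing needs from pseudorandomness. \<open>W\<close> contains all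
  vertices from which a tree may grow, \<open>s\<close> is the size from which sets are joined by an
  edge, and \<open>K\<close> is the number of used pairs that expansion of large sets can
  absorb.\<close>

locale connector =
  fixes E :: "nat \<Rightarrow> nat \<Rightarrow> bool" and M :: "nat set set" and W :: "nat set" and s K :: nat
  assumes E_sym: "E u v \<Longrightarrow> E v u"
    and finite_M: "finite M" and M_pair: "p \<in> M \<Longrightarrow> \<exists>x y. p = {x,y}"
    and M_disjoint: "p \<in> M \<Longrightarrow> q \<in> M \<Longrightarrow> p \<noteq> q \<Longrightarrow> p \<inter> q = {}"
    and finite_W: "finite W" and M_W: "\<Union>M \<subseteq> W" and s_pos: "s \<ge> 1"
    and extendable_empty: "extendable W s (\<lambda>v. {p\<in>M. \<exists>u\<in>p. E v u}) Map.empty"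
    and large_expand: "X \<subseteq> W \<Longrightarrow> s \<le> card X \<Longrightarrow> card X \<le> 2 * s \<Longrightarrow>
      2 * card X + K < card (\<Union>w\<in>X. {p\<in>M. \<exists>u\<in>p. E w u})"
    and joined: "X \<subseteq> W \<Longrightarrow> Y \<subseteq> W \<Longrightarrow> s \<le> card X \<Longrightarrow> s \<le> card Y \<Longrightarrow> \<exists>x\<in>X. \<exists>y\<in>Y. E x y"
begin

definition exits :: "nat \<Rightarrow> nat set set" where
  "exits v = {p\<in>M. \<exists>u\<in>p. E v u}"

text \<open>A forest of pairs: \<open>par\<close> maps every used pair to its parent, the vertex from which the
  pair is entered. Rolling back a part of the forest is restricting the map.\<close>
definition forest :: "(nat set \<Rightarrow> nat option) \<Rightarrow> bool" where
  "forest par \<longleftrightarrow> extendable W s exits par \<and> dom par \<subseteq> M \<and> (\<forall>q\<in>M - dom par. q \<inter> ran par = {})"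

lemma finite_exits: "finite (exits v)"
  unfolding exits_def using finite_M by simp

lemma finite_dom: "forest par \<Longrightarrow> finite (dom par)"
  unfolding forest_def using finite_M finite_subset by blast

lemma forest_empty: "forest Map.empty"
  using extendable_empty unfolding forest_def exits_def by simp

text \<open>Used pairs cost a set at most \<open>card (dom par)\<close> exits, and the slack
  \<open>K\<close> in \<open>large_expand\<close> pays for them.\<close>

lemma card_exits_less:
  assumes "forest par" "card (dom par) \<le> K" "X \<subseteq> W" "s \<le> card X" "card X \<le> 2 * s"
  shows "2 * card X < card (\<Union>w\<in>X. avail exits par w)"
proof -
  have fX: "finite X" using assms(3) finite_W finite_subset by blast
  have "(\<Union>w\<in>X. exits w) \<subseteq> (\<Union>w\<in>X. avail exits par w) \<union> dom par"
    unfolding avail_def by auto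
  then have "card (\<Union>w\<in>X. exits w) \<le> card ((\<Union>w\<in>X. avail exits par w) \<union> dom par)"
    using fX finite_exits finite_dom[OF assms(1)] by (intro card_mono) (auto simp: avail_def)
  also have "\<dots> \<le> card (\<Union>w\<in>X. avail exits par w) + card (dom par)" by (rule card_Un_le)
  finally show ?thesis using large_expand[OF assms(3-5)] assms(2) unfolding exits_def by linarith
qed

lemma forest_add_child:
  assumes f: "forest par" and K: "card (dom par) \<le> K" and x: "x \<in> W" "x \<notin> \<Union>(M - dom par)"
    and few: "card {p. par p = Some x} < 2"
  obtains p u z where "p = {u,z}" "p \<in> M" "E x u" "p \<notin> dom par" "forest (par(p \<mapsto> x))"
proof -
  have "{p \<in> exits x. par p = Some x} \<subseteq> {p. par p = Some x}" by auto
  moreover have "finite {p. par p = Some x}"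
    by (rule finite_subset[OF _ finite_dom[OF f]]) auto
  ultimately have "card {p \<in> exits x. par p = Some x} < 2"
    using few card_mono le_less_trans by blast
  moreover have "extendable W s exits par" using f unfolding forest_def by simp
  ultimately obtain p where p: "p \<in> exits x" "par p = None" "extendable W s exits (par(p \<mapsto> x))"
    using extendable_add_child[OF finite_W finite_exits s_pos _ card_exits_less[OF f K] x(1)] by blast
  from p(1) obtain u where u: "u \<in> p" "E x u" and pM: "p \<in> M" unfolding exits_def by blast
  then obtain z where z: "p = {u,z}" using M_pair[OF pM] by blast
  have "q \<inter> ran (par(p \<mapsto> x)) = {}" if "q \<in> M - dom (par(p \<mapsto> x))" for q
  proof -
    have "q \<in> M - dom par" using that by auto
    then have "q \<inter> ran par = {}" "x \<notin> q" using f x(2) unfolding forest_def by blast+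
    then show ?thesis using p(2) by auto
  qed
  then have "forest (par(p \<mapsto> x))"
    using f p(3) pM unfolding forest_def by auto
  then show thesis using that u z pM p(2) by auto
qed

text \<open>A full binary tree of depth \<open>k\<close> has \<open>2 ^ k\<close> leaves and
  \<open>2 ^ (k + 1) - 2\<close> pairs; the bounds carry \<open>+ 2\<close> in place of subtraction.
  Two child pairs are attached to \<open>v\<close>, then trees of depth \<open>k\<close> grow from
  their far ends one after the other. Bounding \<open>ran par'\<close> shows that roots awaiting
  their turn stay childless.\<close>

lemma grow_tree:
  assumes "forest par" "v \<in> W" "v \<notin> ran par" "v \<notin> \<Union>(M - dom par)"
    "card (dom par) + 2 ^ (k + 1) \<le> K + 2"
  shows "\<exists>par' L. par \<subseteq>\<^sub>m par' \<and> forest par' \<and> card (dom par') + 2 \<le> card (dom par) + 2 ^ (k + 1) \<and>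
    finite L \<and> card L = 2 ^ k \<and> ran par' \<subseteq> insert v (ran par \<union> \<Union>(dom par' - dom par)) \<and>
    L \<subseteq> insert v (\<Union>(dom par' - dom par)) \<and>
    (\<forall>y\<in>L. reaches E par' (dom par' - dom par) k v y)"
  using assms
proof (induction k arbitrary: par v)
  case 0
  have "reaches E par {} 0 v v" unfolding reaches_def by (intro exI[of _ "[]"]) simp
  then show ?case
    using 0 by (intro exI[of _ par] exI[of _ "{v}"]) auto
next
  case (Suc k)
  note f = Suc.prems(1)
  have pow: "(2::nat) ^ (Suc k + 1) = 2 ^ (k + 1) + 2 ^ (k + 1)" "(2::nat) ^ (k + 1) \<ge> 2" by simp_all
  have "{p. par p = Some v} = {}" using Suc.prems(3) by (auto simp: ran_def)
  then have "card {p. par p = Some v} < 2" by simp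
  moreover have "card (dom par) \<le> K" using Suc.prems(5) pow by linarith
  ultimately obtain p1 u1 z1 where p1_eq: "p1 = {u1,z1}" and p1: "p1 \<in> M" "E v u1" "p1 \<notin> dom par"
    and f1': "forest (par(p1 \<mapsto> v))"
    using forest_add_child[OF f _ Suc.prems(2,4)] by metis
  define par1 where "par1 = par(p1 \<mapsto> v)"
  note f1 = f1'[folded par1_def]
  have dom1: "dom par1 = insert p1 (dom par)" unfolding par1_def by simp
  have card1: "card (dom par1) = card (dom par) + 1" unfolding dom1 using p1(3) finite_dom[OF f] by simp
  have "{p. par1 p = Some v} \<subseteq> {p1}" using Suc.prems(3) unfolding par1_def by (auto simp: ran_def)
  then have "card {p. par1 p = Some v} \<le> card {p1}" by (intro card_mono) auto
  then have "card {p. par1 p = Some v} < 2" by simp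
  moreover have "card (dom par1) \<le> K" using Suc.prems(5) pow card1 by linarith
  moreover have "v \<notin> \<Union>(M - dom par1)" using Suc.prems(4) unfolding dom1 by auto
  ultimately obtain p2 u2 z2 where p2_eq: "p2 = {u2,z2}" and p2: "p2 \<in> M" "E v u2" "p2 \<notin> dom par1"
    and f2': "forest (par1(p2 \<mapsto> v))"
    using forest_add_child[OF f1 _ Suc.prems(2)] by metis
  define par2 where "par2 = par1(p2 \<mapsto> v)"
  note f2 = f2'[folded par2_def]
  have p12: "p1 \<noteq> p2" and p2': "p2 \<notin> dom par" using p2(3) unfolding dom1 by auto
  have disj12: "p1 \<inter> p2 = {}" using M_disjoint[OF p1(1) p2(1) p12] .
  have dom2: "dom par2 = insert p2 (insert p1 (dom par))" unfolding par2_def using dom1 by simp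
  have card2: "card (dom par2) = card (dom par) + 2"
    unfolding dom2 using p12 p1(3) p2' finite_dom[OF f] by simp
  have le2: "par \<subseteq>\<^sub>m par2"
  proof (rule map_le_trans)
    show "par \<subseteq>\<^sub>m par1" unfolding par1_def using p1(3) by (intro map_upd_le) auto
    show "par1 \<subseteq>\<^sub>m par2" unfolding par2_def using p2(3) by (intro map_upd_le) auto
  qed
  have ran2: "ran par2 \<subseteq> insert v (ran par)"
    using ran_map_upd_subset[of par1 p2 v] ran_map_upd_subset[of par p1 v]
    unfolding par1_def par2_def by blast
  have free: "p1 \<inter> ran par = {}" "p2 \<inter> ran par = {}"
    using f p1(1,3) p2(1) p2' unfolding forest_def by blast+
  have v_ne: "v \<notin> p1" "v \<notin> p2" using Suc.prems(4) p1(1,3) p2(1) p2' by blast+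
  have zp: "z1 \<in> p1" "z2 \<in> p2" using p1_eq p2_eq by auto
  have z1: "z1 \<in> W" "z1 \<notin> ran par2" "z1 \<notin> \<Union>(M - dom par2)"
  proof -
    show "z1 \<in> W" using M_W p1(1) zp(1) by blast
    show "z1 \<notin> ran par2" using ran2 free(1) v_ne(1) zp(1) by blast
    show "z1 \<notin> \<Union>(M - dom par2)" using M_disjoint[OF p1(1)] zp(1) unfolding dom2 by blast
  qed
  have "card (dom par2) + 2 ^ (k + 1) \<le> K + 2" using card2 Suc.prems(5) pow by linarith
  from Suc.IH[OF f2 z1 this]
  obtain par3 L1 where le3: "par2 \<subseteq>\<^sub>m par3" and f3: "forest par3"
    and card3: "card (dom par3) + 2 \<le> card (dom par2) + 2 ^ (k + 1)"
    and L1: "finite L1" "card L1 = 2 ^ k" "L1 \<subseteq> insert z1 (\<Union>(dom par3 - dom par2))"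
    and ran3: "ran par3 \<subseteq> insert z1 (ran par2 \<union> \<Union>(dom par3 - dom par2))"
    and reach1: "\<forall>y\<in>L1. reaches E par3 (dom par3 - dom par2) k z1 y"
    by blast
  have dom23: "dom par2 \<subseteq> dom par3" using le3 map_le_implies_dom_le by blast
  have dom3M: "dom par3 \<subseteq> M" using f3 unfolding forest_def by blast
  \<comment> \<open>The second root must have survived the growth of the first subtree without
    children: parents added there are \<open>z1\<close> or vertices of that subtree's pairs, all of
    them outside \<open>p2\<close>.\<close>
  have z2: "z2 \<in> W" "z2 \<notin> ran par3" "z2 \<notin> \<Union>(M - dom par3)"
  proof -
    show "z2 \<in> W" using M_W p2(1) zp(2) by blast
    have "z2 \<notin> q" if "q \<in> dom par3 - dom par2" for q
      using M_disjoint[OF p2(1), of q] that dom3M zp(2) unfolding dom2 by blast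
    moreover have "z2 \<notin> ran par2" using ran2 free(2) v_ne(2) zp(2) by blast
    moreover have "z2 \<noteq> z1" using disj12 zp by blast
    ultimately show "z2 \<notin> ran par3" using ran3 by blast
    show "z2 \<notin> \<Union>(M - dom par3)"
      using M_disjoint[OF p2(1)] dom23 zp(2) unfolding dom2 by blast
  qed
  have "card (dom par3) + 2 ^ (k + 1) \<le> K + 2" using card3 card2 Suc.prems(5) pow by linarith
  from Suc.IH[OF f3 z2 this]
  obtain par4 L2 where le4: "par3 \<subseteq>\<^sub>m par4" and f4: "forest par4"
    and card4: "card (dom par4) + 2 \<le> card (dom par3) + 2 ^ (k + 1)"
    and L2: "finite L2" "card L2 = 2 ^ k" "L2 \<subseteq> insert z2 (\<Union>(dom par4 - dom par3))"
    and ran4: "ran par4 \<subseteq> insert z2 (ran par3 \<union> \<Union>(dom par4 - dom par3))"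
    and reach2: "\<forall>y\<in>L2. reaches E par4 (dom par4 - dom par3) k z2 y"
    by blast
  have dom34: "dom par3 \<subseteq> dom par4" using le4 map_le_implies_dom_le by blast
  have dom4M: "dom par4 \<subseteq> M" using f4 unfolding forest_def by blast
  \<comment> \<open>\<open>D1\<close> and \<open>D2\<close> are the pairs of the two subtrees
    together with the pair leading into each. They are disjoint families of disjoint pairs, so the
    two leaf sets are disjoint and their sizes add up.\<close>
  define D1 where "D1 = insert p1 (dom par3 - dom par2)"
  define D2 where "D2 = insert p2 (dom par4 - dom par3)"
  have D_sub: "D1 \<subseteq> dom par4 - dom par" "D2 \<subseteq> dom par4 - dom par"
    unfolding D1_def D2_def using dom23 dom34 p1(3) p2' unfolding dom2 by blast+
  have D12: "D1 \<inter> D2 = {}" unfolding D1_def D2_def using p12 dom23 unfolding dom2 by blast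
  have "q \<inter> r = {}" if "q \<in> D1" "r \<in> D2" for q r
  proof (rule M_disjoint)
    show "q \<in> M" "r \<in> M" using that D_sub dom4M by blast+
    show "q \<noteq> r" using that D12 by blast
  qed
  then have D_disj: "\<Union>D1 \<inter> \<Union>D2 = {}" by blast
  have sub1: "insert z1 (\<Union>(dom par3 - dom par2)) \<subseteq> \<Union>D1"
    using zp(1) unfolding D1_def by auto
  have sub2: "insert z2 (\<Union>(dom par4 - dom par3)) \<subseteq> \<Union>D2"
    using zp(2) unfolding D2_def by auto
  have "L1 \<inter> L2 \<subseteq> \<Union>D1 \<inter> \<Union>D2"
    by (intro Int_mono order_trans[OF L1(3) sub1] order_trans[OF L2(3) sub2])
  then have "L1 \<inter> L2 = {}" using D_disj by simp
  then have card_L: "card (L1 \<union> L2) = 2 ^ Suc k" using L1 L2 by (simp add: card_Un_disjoint)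
  have le24: "par2 \<subseteq>\<^sub>m par4" using map_le_trans[OF le3 le4] .
  have par4: "par4 p1 = Some v" "par4 p2 = Some v"
  proof -
    have "par2 p1 = Some v" "par2 p2 = Some v" using p12 unfolding par1_def par2_def by auto
    then show "par4 p1 = Some v" "par4 p2 = Some v"
      using le24 unfolding map_le_def dom2 by auto
  qed
  have r1: "reaches E par4 (dom par4 - dom par) (Suc k) v y" if "y \<in> L1" for y
  proof -
    have "reaches E par4 (dom par3 - dom par2) k z1 y"
      by (rule reaches_mono[OF reach1[rule_format, OF that] le4]) auto
    moreover have "{u1,z1} \<notin> dom par3 - dom par2" unfolding p1_eq[symmetric] dom2 by simp
    moreover have "par4 {u1,z1} = Some v" unfolding p1_eq[symmetric] by (rule par4(1))
    ultimately have "reaches E par4 D1 (Suc k) v y"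
      unfolding D1_def p1_eq using p1(2) by (intro reaches_Cons)
    moreover have "D1 \<subseteq> dom par4" using D_sub(1) by blast
    ultimately show ?thesis by (rule reaches_mono[OF _ map_le_refl D_sub(1)])
  qed
  have r2: "reaches E par4 (dom par4 - dom par) (Suc k) v y" if "y \<in> L2" for y
  proof -
    have "reaches E par4 (dom par4 - dom par3) k z2 y" using reach2 that by blast
    moreover have "{u2,z2} \<notin> dom par4 - dom par3"
      using dom23 unfolding p2_eq[symmetric] dom2 by simp
    moreover have "par4 {u2,z2} = Some v" unfolding p2_eq[symmetric] by (rule par4(2))
    ultimately have "reaches E par4 D2 (Suc k) v y"
      unfolding D2_def p2_eq using p2(2) by (intro reaches_Cons)
    moreover have "D2 \<subseteq> dom par4" using D_sub(2) by blast
    ultimately show ?thesis by (rule reaches_mono[OF _ map_le_refl D_sub(2)])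
  qed
  have "\<Union>D1 \<union> \<Union>D2 \<subseteq> \<Union>(dom par4 - dom par)"
    by (intro Un_least Union_mono D_sub)
  then have sub: "insert z1 (\<Union>(dom par3 - dom par2)) \<union> insert z2 (\<Union>(dom par4 - dom par3))
      \<subseteq> \<Union>(dom par4 - dom par)"
    using Un_mono[OF sub1 sub2] by (rule order_trans[rotated])
  have "ran par4 \<subseteq> insert v (ran par \<union> A)"
    if "insert z1 B3 \<union> insert z2 B4 \<subseteq> A" "ran par4 \<subseteq> insert z2 (ran par3 \<union> B4)"
      "ran par3 \<subseteq> insert z1 (ran par2 \<union> B3)" for A B3 B4
    using that ran2 by blast
  from this[OF sub ran4 ran3]
  have "ran par4 \<subseteq> insert v (ran par \<union> \<Union>(dom par4 - dom par))" .
  moreover have "L1 \<union> L2 \<subseteq> insert v (\<Union>(dom par4 - dom par))"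
    using order_trans[OF Un_mono[OF L1(3) L2(3)] sub] by (rule subset_insertI2)
  moreover have "card (dom par4) + 2 \<le> card (dom par) + 2 ^ (Suc k + 1)"
    using card4 card3 card2 pow by linarith
  moreover have "par \<subseteq>\<^sub>m par4" using map_le_trans[OF le2 le24] .
  ultimately show ?case
    using f4 L1(1) L2(1) card_L r1 r2
    by (intro exI[of _ par4] exI[of _ "L1 \<union> L2"] conjI ballI) (simp | blast)+
qed

text \<open>Trees grown from both endpoints are joined by an edge; everything outside the resulting path
  is rolled back.\<close>
lemma connect_pair:
  assumes f: "forest par" and ab: "a \<in> W" "b \<in> W" "a \<noteq> b" "a \<notin> ran par" "b \<notin> ran par"
    and abM: "a \<notin> \<Union>M" "b \<notin> \<Union>M"
    and K: "card (dom par) + 2 ^ (k + 2) \<le> K + 2" and k: "s \<le> 2 ^ k"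
  obtains ps par' where "forest par'" "connection E a ps b" "distinct (map pair_of ps)"
    "pair_of ` set ps \<subseteq> M - dom par" "dom par' = dom par \<union> pair_of ` set ps" "length ps \<le> 2 * k"
    "ran par' \<subseteq> {a,b} \<union> ran par \<union> \<Union>M"
proof -
  \<comment> \<open>Both trees stand simultaneously, and each is charged
    \<open>2 ^ (k + 1)\<close>.\<close>
  have pow: "(2::nat) ^ (k + 2) = 2 ^ (k + 1) + 2 ^ (k + 1)" by simp
  have "card (dom par) + 2 ^ (k + 1) \<le> K + 2" using K pow by linarith
  then obtain par1 La where le1: "par \<subseteq>\<^sub>m par1" and f1: "forest par1"
    and card1: "card (dom par1) + 2 \<le> card (dom par) + 2 ^ (k + 1)"
    and La: "finite La" "card La = 2 ^ k" "La \<subseteq> insert a (\<Union>(dom par1 - dom par))"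
    and ran1: "ran par1 \<subseteq> insert a (ran par \<union> \<Union>(dom par1 - dom par))"
    and reach_a: "\<forall>y\<in>La. reaches E par1 (dom par1 - dom par) k a y"
    using grow_tree[OF f ab(1,4), of k] abM(1) by blast
  have dom1M: "dom par1 \<subseteq> M" using f1 unfolding forest_def by blast
  \<comment> \<open>New parents in the first tree are \<open>a\<close> itself or vertices of
    \<open>\<Union>M\<close>, and \<open>b\<close> is neither.\<close>
  have b1: "b \<notin> ran par1" using ran1 dom1M ab(3,5) abM(2) by blast
  have "card (dom par1) + 2 ^ (k + 1) \<le> K + 2" using K card1 pow by linarith
  then obtain par2 Lb where le2: "par1 \<subseteq>\<^sub>m par2" and f2: "forest par2"
    and Lb: "finite Lb" "card Lb = 2 ^ k" "Lb \<subseteq> insert b (\<Union>(dom par2 - dom par1))"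
    and reach_b: "\<forall>y\<in>Lb. reaches E par2 (dom par2 - dom par1) k b y"
    using grow_tree[OF f1 ab(2) b1, of k] abM(2) by blast
  have dom2M: "dom par2 \<subseteq> M" using f2 unfolding forest_def by blast
  have "La \<subseteq> W" "Lb \<subseteq> W" using La(3) Lb(3) dom1M dom2M ab(1,2) M_W by blast+
  then obtain ya yb where y: "ya \<in> La" "yb \<in> Lb" "E ya yb"
    using joined[of La Lb] La(2) Lb(2) k by metis
  have dom12: "dom par1 \<subseteq> dom par2" using le2 map_le_implies_dom_le by blast
  have dom01: "dom par \<subseteq> dom par1" using le1 map_le_implies_dom_le by blast
  have "reaches E par2 (dom par1 - dom par) k a ya"
    by (rule reaches_mono[OF reach_a[rule_format, OF y(1)] le2]) auto
  then obtain pa where pa: "walk E a pa ya" "distinct (map pair_of pa)"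
    "pair_of ` set pa \<subseteq> dom par1 - dom par" "length pa \<le> k"
    and par_a: "\<forall>q\<in>pair_of ` set pa. \<exists>w\<in>insert a (\<Union>(pair_of ` set pa)). par2 q = Some w"
    unfolding reaches_def by blast
  obtain pb where pb: "walk E b pb yb" "distinct (map pair_of pb)"
    "pair_of ` set pb \<subseteq> dom par2 - dom par1" "length pb \<le> k"
    and par_b: "\<forall>q\<in>pair_of ` set pb. \<exists>w\<in>insert b (\<Union>(pair_of ` set pb)). par2 q = Some w"
    using reach_b[rule_format, OF y(2)] unfolding reaches_def by blast
  define ps where "ps = pa @ map prod.swap (rev pb)"
  have swap: "pair_of (prod.swap e) = pair_of e" for e :: "nat \<times> nat" by (auto simp: pair_of_def)
  have pairs: "pair_of ` set ps = pair_of ` set pa \<union> pair_of ` set pb"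
    by (simp add: ps_def image_Un image_image swap)
  have "connection E b (pb @ []) ya"
    by (rule connection_append[OF pb(1)]) (use y(3) E_sym in simp)
  then have "connection E ya (map prod.swap (rev pb)) b"
    using connection_rev[of E b pb ya] E_sym by simp
  then have conn: "connection E a ps b" unfolding ps_def by (rule connection_append[OF pa(1)])
  have "pair_of ` set pa \<inter> pair_of ` set pb = {}" using pa(3) pb(3) by blast
  moreover have "map pair_of ps = map pair_of pa @ rev (map pair_of pb)"
    by (simp add: ps_def comp_def swap rev_map)
  ultimately have dist: "distinct (map pair_of ps)" using pa(2) pb(2) by simp
  define Q where "Q = pair_of ` set ps"
  have "dom par1 - dom par \<subseteq> dom par2 - dom par" "dom par2 - dom par1 \<subseteq> dom par2 - dom par"
    using dom12 dom01 by blast+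
  then have Q_new: "Q \<subseteq> dom par2 - dom par"
    unfolding Q_def pairs by (intro Un_least order_trans[OF pa(3)] order_trans[OF pb(3)])
  then have Q_M: "Q \<subseteq> M - dom par" using dom2M by blast
  define par' where "par' = par2 |` (dom par \<union> Q)"
  have "dom par \<union> Q \<subseteq> dom par2" using Q_new dom01 dom12 by blast
  then have dom': "dom par' = dom par \<union> Q" unfolding par'_def dom_restrict by (rule Int_absorb1)
  \<comment> \<open>Here the last conjunct of \<open>reaches\<close> pays off: the parents of kept
    path pairs are \<open>a\<close>, \<open>b\<close> or vertices of the path. Pairs released by the
    rollback are disjoint from all of these, as \<open>forest\<close> demands.\<close>
  have ran': "w \<in> {a,b} \<union> ran par \<union> \<Union>Q" if "w \<in> ran par'" for w
  proof -
    obtain q where q: "par' q = Some w" using \<open>w \<in> ran par'\<close> by (auto simp: ran_def)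
    then have q2: "par2 q = Some w" and "q \<in> dom par \<union> Q"
      unfolding par'_def by (auto simp: restrict_map_def split: if_splits)
    then consider "q \<in> dom par" | "q \<in> pair_of ` set pa" | "q \<in> pair_of ` set pb"
      unfolding Q_def pairs by blast
    then show ?thesis
    proof cases
      case 1
      then have "par q = Some w" using map_le_trans[OF le1 le2] q2 by (simp add: map_le_def)
      then show ?thesis by (auto simp: ran_def)
    next
      case 2
      then have "w \<in> insert a (\<Union>(pair_of ` set pa))" using bspec[OF par_a 2] q2 by auto
      then show ?thesis unfolding Q_def pairs by auto
    next
      case 3
      then have "w \<in> insert b (\<Union>(pair_of ` set pb))" using bspec[OF par_b 3] q2 by auto
      then show ?thesis unfolding Q_def pairs by auto
    qed
  qed
  have "forest par'"
    unfolding forest_def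
  proof (intro conjI ballI)
    have "extendable W s exits par2" using f2 unfolding forest_def by simp
    moreover have "par' \<subseteq>\<^sub>m par2" unfolding par'_def by (auto simp: map_le_def)
    ultimately show "extendable W s exits par'"
      by (rule extendable_mono[OF finite_W finite_exits])
    show "dom par' \<subseteq> M" unfolding dom' using f Q_M unfolding forest_def by blast
    fix q assume q: "q \<in> M - dom par'"
    then have qM: "q \<in> M" and "q \<notin> dom par" "q \<notin> Q" unfolding dom' by auto
    then have "q \<inter> ran par = {}" using f unfolding forest_def by blast
    moreover have "q \<inter> r = {}" if "r \<in> Q" for r
      using Q_M that \<open>q \<notin> Q\<close> by (intro M_disjoint[OF qM]) auto
    moreover have "a \<notin> q" "b \<notin> q" using qM abM by blast+
    ultimately have "w \<notin> q" if "w \<in> ran par'" for w using ran'[OF that] by blast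
    then show "q \<inter> ran par' = {}" by blast
  qed
  moreover have "length ps \<le> 2 * k" using pa(4) pb(4) by (simp add: ps_def)
  moreover have "ran par' \<subseteq> {a,b} \<union> ran par \<union> \<Union>M"
  proof
    fix w assume "w \<in> ran par'"
    then have "w \<in> {a,b} \<union> ran par \<union> \<Union>Q" by (rule ran')
    moreover have "\<Union>Q \<subseteq> \<Union>M" using Q_M by (intro Union_mono) blast
    ultimately show "w \<in> {a,b} \<union> ran par \<union> \<Union>M" by blast
  qed
  ultimately show thesis
    using that[OF _ conn dist] Q_M dom' unfolding Q_def by simp
qed

definition routed :: "nat \<Rightarrow> nat set set \<Rightarrow> (nat set \<Rightarrow> nat option) \<Rightarrow> (nat set \<Rightarrow> (nat \<times> nat) list) \<Rightarrow> bool" where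
  "routed k P par path \<longleftrightarrow>
    forest par \<and> card (dom par) \<le> card P * (2 * k) \<and> ran par \<subseteq> \<Union>P \<union> \<Union>M \<and>
    (\<forall>p\<in>P. \<exists>a b. p = {a,b} \<and> alt_path E M a b (path p)) \<and>
    (\<forall>p\<in>P. set (path_verts (path p)) \<subseteq> p \<union> \<Union>(dom par)) \<and>
    (\<forall>p\<in>P. \<forall>q\<in>P. p \<noteq> q \<longrightarrow> set (path_verts (path p)) \<inter> set (path_verts (path q)) = {})"

text \<open>Each linked pair permanently keeps at most \<open>2 * k\<close> pairs of
  \<open>M\<close>, while the \<open>2 ^ (k + 2)\<close> for trees is temporary and reused at every
  step; hence the shape of the capacity condition.\<close>

lemma connect_all:
  assumes "finite P" and "\<And>p. p \<in> P \<Longrightarrow> \<exists>a b. p = {a,b} \<and> a \<noteq> b \<and> a \<in> W \<and> b \<in> W"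
    and "\<And>p q. p \<in> P \<Longrightarrow> q \<in> P \<Longrightarrow> p \<noteq> q \<Longrightarrow> p \<inter> q = {}" and "\<Union>P \<inter> \<Union>M = {}"
    and "card P * (2 * k) + 2 ^ (k + 2) \<le> K + 2" and k: "s \<le> 2 ^ k"
  shows "\<exists>par path. routed k P par path"
  using assms(1-5)
proof (induction P rule: finite_induct)
  case empty
  have "routed k {} Map.empty path" for path using forest_empty by (simp add: routed_def)
  then show ?case by blast
next
  case (insert p P)
  have cardP: "card (insert p P) * (2 * k) = card P * (2 * k) + 2 * k" using insert.hyps by simp
  have "\<exists>par path. routed k P par path"
  proof (rule insert.IH)
    show "card P * (2 * k) + 2 ^ (k + 2) \<le> K + 2" using insert.prems(4) cardP by linarith
    show "\<Union>P \<inter> \<Union>M = {}" using insert.prems(3) by blast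
    show "q \<inter> r = {}" if "q \<in> P" "r \<in> P" "q \<noteq> r" for q r
      using that by (intro insert.prems(2)) auto
    show "\<exists>a b. q = {a,b} \<and> a \<noteq> b \<and> a \<in> W \<and> b \<in> W" if "q \<in> P" for q
      using that by (intro insert.prems(1)) simp
  qed
  then obtain par path where "routed k P par path" by blast
  note routed = this[unfolded routed_def]
  note f = routed[THEN conjunct1]
    and card_par = routed[THEN conjunct2, THEN conjunct1]
    and ran = routed[THEN conjunct2, THEN conjunct2, THEN conjunct1]
    and paths = routed[THEN conjunct2, THEN conjunct2, THEN conjunct2, THEN conjunct1]
    and verts = routed[THEN conjunct2, THEN conjunct2, THEN conjunct2, THEN conjunct2, THEN conjunct1]
    and disj = routed[THEN conjunct2, THEN conjunct2, THEN conjunct2, THEN conjunct2, THEN conjunct2]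
  obtain a b where p: "p = {a,b}" "a \<noteq> b" "a \<in> W" "b \<in> W" using insert.prems(1)[of p] by auto
  have p_disj: "p \<inter> q = {}" if "q \<in> P" for q
    using insert.hyps that by (intro insert.prems(2)) auto
  have abM: "a \<notin> \<Union>M" "b \<notin> \<Union>M" using insert.prems(3) p(1) by auto
  have "a \<notin> \<Union>P" "b \<notin> \<Union>P" using p_disj p(1) by auto
  then have abr: "a \<notin> ran par" "b \<notin> ran par" using ran abM by blast+
  have "card (dom par) + 2 ^ (k + 2) \<le> K + 2" using card_par insert.prems(4) cardP by linarith
  from connect_pair[OF f p(3,4,2) abr abM this k]
  obtain ps par' where f': "forest par'" and conn: "connection E a ps b"
    and dist: "distinct (map pair_of ps)" and new: "pair_of ` set ps \<subseteq> M - dom par"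
    and dom': "dom par' = dom par \<union> pair_of ` set ps" and len: "length ps \<le> 2 * k"
    and ran': "ran par' \<subseteq> {a,b} \<union> ran par \<union> \<Union>M"
    by metis
  define path' where "path' = path(p := edges_of a ps b)"
  have psM: "pair_of ` set ps \<subseteq> M" using new by blast
  note ape = alt_path_edges_of[OF conn dist psM M_disjoint p(2) abM]
  have alt: "alt_path E M a b (edges_of a ps b)" using ape(1) .
  have path'_q: "path' q = path q" if "q \<in> P" for q
    using that insert.hyps by (auto simp: path'_def)
  have path'_p: "path' p = edges_of a ps b" by (simp add: path'_def)
  have pv: "set (path_verts (path' p)) = p \<union> \<Union>(pair_of ` set ps)"
    using ape(2) p(1) path'_p by simp
  have domM: "dom par \<subseteq> M" using f unfolding forest_def by simp
  have new_disj: "set (path_verts (path' p)) \<inter> set (path_verts (path' q)) = {}" if q: "q \<in> P" for q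
  proof -
    have "r \<inter> r' = {}" if "r \<in> pair_of ` set ps" "r' \<in> dom par" for r r'
      using that new domM by (intro M_disjoint) blast+
    then have 1: "\<Union>(pair_of ` set ps) \<inter> \<Union>(dom par) = {}" by blast
    have 2: "p \<inter> \<Union>M = {}" "q \<inter> \<Union>M = {}" using insert.prems(3) q by auto
    have "(p \<union> A) \<inter> (q \<union> B) = {}"
      if "A \<inter> B = {}" "A \<subseteq> Z" "B \<subseteq> Z" "p \<inter> Z = {}" "q \<inter> Z = {}" for A B Z
      using that p_disj[OF q] by blast
    from this[OF 1 Union_mono[OF psM] Union_mono[OF domM] 2]
    have "set (path_verts (path' p)) \<inter> (q \<union> \<Union>(dom par)) = {}" unfolding pv .
    moreover have "set (path_verts (path' q)) \<subseteq> q \<union> \<Union>(dom par)"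
      using bspec[OF verts q] path'_q[OF q] by simp
    ultimately show ?thesis
      using Int_mono[OF order_refl] by (metis subset_empty)
  qed
  have "routed k (insert p P) par' path'"
    unfolding routed_def
  proof (intro conjI)
    have "card (dom par') \<le> card (dom par) + card (pair_of ` set ps)" unfolding dom' by (rule card_Un_le)
    moreover have "card (pair_of ` set ps) \<le> length ps"
      by (metis card_length length_map set_map)
    ultimately show "card (dom par') \<le> card (insert p P) * (2 * k)" using card_par len cardP by linarith
    show "ran par' \<subseteq> \<Union>(insert p P) \<union> \<Union>M" using ran' ran p(1) by auto
    show "\<forall>q\<in>insert p P. \<exists>a b. q = {a,b} \<and> alt_path E M a b (path' q)"
      using paths path'_q path'_p alt p(1) by auto
    show "\<forall>q\<in>insert p P. set (path_verts (path' q)) \<subseteq> q \<union> \<Union>(dom par')"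
    proof
      fix q assume "q \<in> insert p P"
      then show "set (path_verts (path' q)) \<subseteq> q \<union> \<Union>(dom par')"
        using bspec[OF verts, of q] path'_q[of q] pv unfolding dom' Union_Un_distrib by (cases "q = p") auto
    qed
    show "\<forall>q\<in>insert p P. \<forall>r\<in>insert p P. q \<noteq> r \<longrightarrow>
        set (path_verts (path' q)) \<inter> set (path_verts (path' r)) = {}"
    proof (intro ballI impI)
      fix q r assume qr: "q \<in> insert p P" "r \<in> insert p P" "q \<noteq> r"
      then consider "q = p" "r \<in> P" | "r = p" "q \<in> P" | "q \<in> P" "r \<in> P" by blast
      then show "set (path_verts (path' q)) \<inter> set (path_verts (path' r)) = {}"
      proof cases
        case 1
        then show ?thesis using new_disj[of r] by simp
      next
        case 2
        then show ?thesis using new_disj[of q] by (simp add: Int_commute)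
      next
        case 3
        then show ?thesis using disj qr(3) path'_q by simp
      qed
    qed
  qed (rule f')
  then show ?case by blast
qed

end

section \<open>Expansion in pseudorandom graphs\<close>

text \<open>With no edges, the mixing lemma bounds the main term d q^2 / n by lam q, where q is the
  geometric mean of the sizes; cancel q.\<close>

lemma card_no_edges_le:
  assumes G: "ndl_graph n d lam E" and d: "real d > lam" and S: "S \<subseteq> {0..<n}" and T: "T \<subseteq> {0..<n}"
    and no: "\<And>x y. x \<in> S \<Longrightarrow> y \<in> T \<Longrightarrow> \<not> E x y"
  shows "real (card S) * real (card T) \<le> (lam * real n / real d)\<^sup>2"
proof -
  define q where "q = sqrt (real (card S) * real (card T))"
  have q: "q \<ge> 0" "real (card S) * real (card T) = q\<^sup>2" by (simp_all add: q_def)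
  have n: "n \<ge> 2" and d0: "real d > 0" using G d second_abs_eigenvalue_nonneg[OF G] by (auto simp: ndl_graph_def)
  have "nbhd E v \<inter> T = {}" if "v \<in> S" for v using no that by (auto simp: nbhd_def)
  then have "edge_count E S T = 0" by (simp add: edge_count_def)
  then have "real d * real (card S) * real (card T) / real n \<le> lam * q"
    using expander_mixing[OF G d S T] by (simp add: q_def)
  moreover have "real d * real (card S) * real (card T) / real n = q * (real d * q / real n)"
    by (simp only: mult.assoc q(2)) (simp add: power2_eq_square)
  ultimately have le: "q * (real d * q / real n) \<le> q * lam" by (metis mult.commute)
  have "q \<le> lam * real n / real d"
  proof (cases "q = 0")
    case True
    then show ?thesis using second_abs_eigenvalue_nonneg[OF G] by simp
  next
    case False
    then have "q > 0" using q(1) by simp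
    with le have "real d * q / real n \<le> lam" by (rule mult_left_le_imp_le)
    then show ?thesis using n d0 by (simp add: field_simps)
  qed
  then show ?thesis unfolding q(2) using q(1) by (rule power_mono)
qed

text \<open>A single vertex carries no loop, so the bound for sets without edges applies to it
  against itself.\<close>

lemma ndl_ratio_ge_1:
  assumes G: "ndl_graph n d lam E" and d: "real d > lam"
  shows "lam * real n / real d \<ge> 1"
proof -
  from G have n: "n \<ge> 2" and g: "graph_on n E" by (auto simp: ndl_graph_def regular_graph_def)
  have "real (card {0::nat}) * real (card {0::nat}) \<le> (lam * real n / real d)\<^sup>2"
    using n g by (intro card_no_edges_le[OF G d]) (auto simp: graph_on_def)
  then have "1\<^sup>2 \<le> (lam * real n / real d)\<^sup>2" by simp
  moreover have "lam * real n / real d \<ge> 0" using second_abs_eigenvalue_nonneg[OF G] by simp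
  ultimately show ?thesis by (rule power2_le_imp_le)
qed

text \<open>A nonempty \<open>X\<close> would send at least c lam |X| edges into \<open>T\<close>.
  The mixing lemma allows at most 16 lam |X| from the main term and 2 lam |X| from the error, which
  is the origin of 18.\<close>

lemma min_degree_expansion:
  assumes G: "ndl_graph n d lam E" and d: "real d > lam" and X: "X \<subseteq> {0..<n}" and T: "T \<subseteq> {0..<n}"
    and deg: "\<And>v. v \<in> X \<Longrightarrow> real (card (nbhd E v \<inter> T)) \<ge> c * lam"
    and XT: "real (card T) \<le> 4 * real (card X)" and Tm: "real (card T) \<le> 16 * (lam * real n / real d)"
    and c: "c > 18"
  shows "X = {}"
proof (rule ccontr)
  assume "X \<noteq> {}"
  moreover have "finite X" using X finite_subset by blast
  ultimately have x: "real (card X) > 0" by (simp add: card_gt_0_iff)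
  have n: "n \<ge> 2" and d0: "real d > 0" and l0: "lam \<ge> 0"
    using G d second_abs_eigenvalue_nonneg[OF G] by (auto simp: ndl_graph_def)
  have l: "lam > 0" using ndl_ratio_ge_1[OF G d] l0 by (cases "lam = 0") auto
  have "c * lam * real (card X) = (\<Sum>v\<in>X. c * lam)" by simp
  also have "\<dots> \<le> (\<Sum>v\<in>X. real (card (nbhd E v \<inter> T)))" using deg by (rule sum_mono)
  also have "\<dots> = real (edge_count E X T)" by (simp add: edge_count_def)
  also have "\<dots> \<le> real d * real (card X) * real (card T) / real n + lam * sqrt (real (card X) * real (card T))"
    using expander_mixing[OF G d X T] by linarith
  also have "real d * real (card X) * real (card T) / real n \<le> 16 * lam * real (card X)"
  proof -
    have "real d * real (card T) / real n \<le> 16 * lam" using Tm n d0 by (simp add: field_simps)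
    then have "real (card X) * (real d * real (card T) / real n) \<le> real (card X) * (16 * lam)"
      by (rule mult_left_mono) simp
    then show ?thesis by (simp add: mult_ac)
  qed
  also have "sqrt (real (card X) * real (card T)) \<le> 2 * real (card X)"
  proof (rule real_le_lsqrt)
    have "real (card X) * real (card T) \<le> real (card X) * (4 * real (card X))"
      using XT by (rule mult_left_mono) simp
    then show "real (card X) * real (card T) \<le> (2 * real (card X))\<^sup>2" by (simp add: power2_eq_square)
  qed simp
  finally have "c * (lam * real (card X)) \<le> 18 * (lam * real (card X))" using l by (simp add: algebra_simps)
  then show False using c l x by (simp add: mult_le_cancel_right)
qed

text \<open>Choosing one element from each member is injective. It serves to count missed pairs by
  uncovered vertices, and all of \<open>M\<close> by \<open>n\<close>.\<close>

lemma card_disjoint_family_le: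
  assumes "finite Y" "\<Union>Q \<subseteq> Y" "{} \<notin> Q" "\<And>p q. p \<in> Q \<Longrightarrow> q \<in> Q \<Longrightarrow> p \<noteq> q \<Longrightarrow> p \<inter> q = {}"
  shows "card Q \<le> card Y"
proof -
  define f where "f p = (SOME x. x \<in> p)" for p :: "'a set"
  have f: "f p \<in> p" if "p \<in> Q" for p
  proof -
    have "p \<noteq> {}" using that assms(3) by blast
    then show ?thesis unfolding f_def by (simp add: some_in_eq)
  qed
  have "inj_on f Q"
  proof (rule inj_onI)
    fix p q assume "p \<in> Q" "q \<in> Q" "f p = f q"
    then have "f p \<in> p \<inter> q" using f[of p] f[of q] by simp
    then show "p = q" using assms(4) \<open>p \<in> Q\<close> \<open>q \<in> Q\<close> by blast
  qed
  moreover have "f ` Q \<subseteq> Y" using f assms(2) by blast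
  ultimately show ?thesis using assms(1) by (rule card_inj_on_le)
qed

lemma expander_alternating_paths:
  fixes lam :: real
  assumes G: "ndl_graph n d lam E" and dl: "real d > 500 * lam"
    and M: "disjoint_pairs n M" and cl: "clean E (500 * lam) (\<Union>M)"
    and cardM: "real (card M) \<ge> 2000 * lam * real n / real d"
    and P: "finite P" "\<forall>p\<in>P. \<exists>a b. p = {a, b} \<and> a \<noteq> b \<and> a < n \<and> b < n"
      "\<forall>p\<in>P. \<forall>q\<in>P. p \<noteq> q \<longrightarrow> p \<inter> q = {}" "\<Union>P \<inter> \<Union>M = {}"
    and cardP: "real (card P) \<le> real (card M) / (100 * log 2 (real n))"
    and degP: "\<forall>v\<in>\<Union>P. real (card (nbhd E v \<inter> \<Union>M)) \<ge> 500 * lam"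
  shows "\<exists>path :: nat set \<Rightarrow> (nat \<times> nat) list.
    (\<forall>a b. {a, b} \<in> P \<longrightarrow> alt_path E M a b (path {a, b}) \<or> alt_path E M b a (path {a, b})) \<and>
    (\<forall>p\<in>P. \<forall>q\<in>P. p \<noteq> q \<longrightarrow> set (path_verts (path p)) \<inter> set (path_verts (path q)) = {})"
proof -
  \<comment> \<open>Sets larger than \<open>m\<close> are joined by an edge. \<open>s\<close> is the
    least natural number strictly above \<open>m\<close>, and \<open>m \<ge> 1\<close> gives
    \<open>s \<le> 2 * m\<close>. \<open>K\<close> reserves half of \<open>M\<close> for
    use.\<close>
  define m where "m = lam * real n / real d"
  define s where "s = nat \<lfloor>m\<rfloor> + 1"
  define W where "W = \<Union>M \<union> \<Union>P"
  define K where "K = card M div 2"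
  have l0: "lam \<ge> 0" using second_abs_eigenvalue_nonneg[OF G] .
  then have d: "real d > lam" using dl by linarith
  from G have n: "n \<ge> 2" and g: "graph_on n E" by (auto simp: ndl_graph_def regular_graph_def)
  have m1: "m \<ge> 1" unfolding m_def by (rule ndl_ratio_ge_1[OF G d])
  have s: "real s > m" "real s \<le> 2 * m" "s \<ge> 1" using m1 unfolding s_def by linarith+
  have Mm: "real (card M) \<ge> 2000 * m" using cardM by (simp add: m_def)
  have finM: "finite M" and Mpair: "\<And>p. p \<in> M \<Longrightarrow> \<exists>x y. p = {x,y} \<and> x < n \<and> y < n"
    and Mdisj: "\<And>p q. p \<in> M \<Longrightarrow> q \<in> M \<Longrightarrow> p \<noteq> q \<Longrightarrow> p \<inter> q = {}"
    using M unfolding disjoint_pairs_def by auto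
  have Mne: "{} \<notin> M" using Mpair by blast
  have MV: "\<Union>M \<subseteq> {0..<n}"
  proof
    fix x assume "x \<in> \<Union>M"
    then obtain p where "p \<in> M" "x \<in> p" by blast
    then show "x \<in> {0..<n}" using Mpair[of p] by auto
  qed
  have PV: "\<Union>P \<subseteq> {0..<n}"
  proof
    fix x assume "x \<in> \<Union>P"
    then obtain p where "p \<in> P" "x \<in> p" by blast
    then show "x \<in> {0..<n}" using P(2) by fastforce
  qed
  have WV: "W \<subseteq> {0..<n}" using MV PV unfolding W_def by simp
  have finW: "finite W" using WV finite_subset by blast
  have degW: "real (card (nbhd E v \<inter> \<Union>M)) \<ge> 500 * lam" if "v \<in> W" for v
    using that cl degP unfolding W_def clean_def by blast
  define F where "F X = (\<Union>w\<in>X. {p\<in>M. \<exists>u\<in>p. E w u})" for X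
  have F_M: "F X \<subseteq> M" for X unfolding F_def by blast
  have finF: "finite (F X)" for X using F_M finM by (rule finite_subset)
  \<comment> \<open>If \<open>X\<close> met too few pairs, their union would have at most 4|X| \<le>
    16 m vertices. Yet it contains all neighbours in \<open>\<Union>M\<close> of vertices of
    \<open>X\<close>, at least 500 lam for each, and 500 > 18.\<close>
  have small: "2 * card X \<le> card (F X)" if X: "X \<subseteq> W" "card X \<le> 2 * s" for X
  proof (rule ccontr)
    assume neg: "\<not> ?thesis"
    let ?T = "\<Union>(F X)"
    have "card ?T \<le> (\<Sum>p\<in>F X. card p)" by (rule card_Union_le_sum_card)
    also have "\<dots> \<le> (\<Sum>p\<in>F X. 2)"
    proof (rule sum_mono)
      fix p assume "p \<in> F X"
      then have "p \<in> M" using F_M by blast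
      then obtain x y where "p = {x,y}" using Mpair by blast
      then show "card p \<le> 2" by (simp add: card_insert_if)
    qed
    finally have "card ?T \<le> 2 * card (F X)" by simp
    then have cT: "real (card ?T) \<le> 4 * real (card X)" using neg by linarith
    have "X = {}"
    proof (rule min_degree_expansion[OF G d, where T = "?T" and c = 500])
      show "X \<subseteq> {0..<n}" using X WV by blast
      show "?T \<subseteq> {0..<n}" using Union_mono[OF F_M] MV by (rule order_trans)
      show "real (card ?T) \<le> 4 * real (card X)" by (rule cT)
      have "real (card X) \<le> 4 * m" using X(2) s(2) by linarith
      then show "real (card ?T) \<le> 16 * (lam * real n / real d)" using cT by (simp add: m_def)
      fix v assume v: "v \<in> X"
      have "nbhd E v \<inter> \<Union>M \<subseteq> nbhd E v \<inter> ?T" using v unfolding F_def nbhd_def by blast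
      then have "card (nbhd E v \<inter> \<Union>M) \<le> card (nbhd E v \<inter> ?T)"
        using finite_subset[OF nbhd_subset[OF g, of v]] by (intro card_mono) auto
      then show "500 * lam \<le> real (card (nbhd E v \<inter> ?T))" using degW[of v] v X(1) by fastforce
    qed simp
    then show False using neg by simp
  qed
  \<comment> \<open>The vertices \<open>Y\<close> of \<open>\<Union>M\<close> without neighbour in
    \<open>X\<close> number at most \<open>m\<close>, because |X| > m. A pair missed by
    \<open>F X\<close> lies inside \<open>Y\<close>, so at most \<open>m\<close> pairs are missed.
    Half of |M| \<ge> 2000 m exceeds m + 2|X| \<le> 9 m.\<close>
  have large: "2 * card X + K < card (F X)"
    if X: "X \<subseteq> W" "s \<le> card X" "card X \<le> 2 * s" for X
  proof -
    define Y where "Y = \<Union>M - (\<Union>w\<in>X. nbhd E w)"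
    have YV: "Y \<subseteq> {0..<n}" using MV unfolding Y_def by blast
    have "real (card X) * real (card Y) \<le> m\<^sup>2"
      unfolding m_def using X(1) WV YV
      by (intro card_no_edges_le[OF G d]) (auto simp: Y_def nbhd_def)
    moreover have "m * real (card Y) \<le> real (card X) * real (card Y)"
      using X(2) s(1) by (intro mult_right_mono) auto
    ultimately have "m * real (card Y) \<le> m * m" by (simp add: power2_eq_square)
    then have cY: "real (card Y) \<le> m" using m1 by simp
    have "card (M - F X) \<le> card Y"
    proof (rule card_disjoint_family_le)
      show "finite Y" using YV finite_subset by blast
      show "\<Union>(M - F X) \<subseteq> Y" unfolding Y_def F_def nbhd_def by blast
      show "{} \<notin> M - F X" using Mne by blast
      show "p \<inter> q = {}" if "p \<in> M - F X" "q \<in> M - F X" "p \<noteq> q" for p q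
        using that by (intro Mdisj) auto
    qed
    moreover have "card (M - F X) = card M - card (F X)" using finF F_M by (rule card_Diff_subset)
    moreover have "real K \<le> real (card M) / 2" unfolding K_def by linarith
    ultimately have "real (2 * card X + K) < real (card (F X))"
      using cY X(3) s(2) Mm m1 by linarith
    then show ?thesis by linarith
  qed
  interpret connector E M W s K
  proof
    show "E u v \<Longrightarrow> E v u" for u v using g unfolding graph_on_def by blast
    show "finite M" by (rule finM)
    show "\<exists>x y. p = {x,y}" if "p \<in> M" for p using Mpair[OF that] by blast
    show "p \<inter> q = {}" if "p \<in> M" "q \<in> M" "p \<noteq> q" for p q using that by (rule Mdisj)
    show "finite W" by (rule finW)
    show "\<Union>M \<subseteq> W" unfolding W_def by blast
    show "s \<ge> 1" by (rule s(3))
    show "extendable W s (\<lambda>v. {p\<in>M. \<exists>u\<in>p. E v u}) Map.empty"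
      unfolding extendable_def avail_def using small unfolding F_def by simp
    show "2 * card X + K < card (\<Union>w\<in>X. {p\<in>M. \<exists>u\<in>p. E w u})"
      if "X \<subseteq> W" "s \<le> card X" "card X \<le> 2 * s" for X
      using large[OF that] unfolding F_def .
    show "\<exists>x\<in>X. \<exists>y\<in>Y. E x y" if XY: "X \<subseteq> W" "Y \<subseteq> W" "s \<le> card X" "s \<le> card Y" for X Y
    proof (rule ccontr)
      assume "\<not> ?thesis"
      then have "real (card X) * real (card Y) \<le> m\<^sup>2"
        unfolding m_def using XY(1,2) WV by (intro card_no_edges_le[OF G d]) auto
      moreover have "m * m < real (card X) * real (card Y)"
        using XY(3,4) s(1) m1 by (intro mult_strict_mono) auto
      ultimately show False by (simp add: power2_eq_square)
    qed
  qed
  \<comment> \<open>The next power of two above \<open>s\<close> is at most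
    \<open>2 * s \<le> 4 * m\<close>: enough leaves to be joined, and cheap enough for the
    budget.\<close>
  obtain j where j: "2 ^ j \<le> s" "s < 2 ^ (j + 1)" using ex_power_ivl1[of 2 s] s(3) by auto
  define k where "k = j + 1"
  have k: "s \<le> 2 ^ k" using j(2) by (simp add: k_def)
  have "2 ^ k \<le> 2 * s" using j(1) by (simp add: k_def)
  then have "real (2 ^ k) \<le> real (2 * s)" by (simp only: of_nat_le_iff)
  then have k2: "2 ^ k \<le> 4 * m" using s(2) by simp
  have Mn: "card M \<le> n"
    using card_disjoint_family_le[of "{0..<n}" M] MV Mne Mdisj by simp
  \<comment> \<open>The chain 2^k \<le> 4 m \<le> |M| \<le> n bounds the tree depth by log2
    n.\<close>
  then have "2 ^ k \<le> real n" using k2 Mm m1 by linarith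
  then have klog: "real k \<le> log 2 (real n)" using n by (simp add: le_log_iff powr_realpow)
  have L1: "log 2 (real n) \<ge> 1" using n by (simp add: le_log_iff)
  \<comment> \<open>The logarithm in the bound on |P| cancels against the path length, leaving
    |M|/50 for all paths. The trees add 4 * 2^k \<le> 16 m \<le> |M|/125, well below |M|/2.\<close>
  have "real (card P) * (2 * real k) \<le> real (card M) / (100 * log 2 (real n)) * (2 * log 2 (real n))"
    using cardP klog L1 by (intro mult_mono) auto
  also have "\<dots> = real (card M) / 50" using L1 by (simp add: field_simps)
  finally have "real (card P) * (2 * real k) \<le> real (card M) / 50" .
  moreover have "real (card M) / 2 - 1 \<le> real K" unfolding K_def by linarith
  ultimately have "real (card P) * (2 * real k) + 4 * 2 ^ k \<le> real K + 2" using k2 Mm m1 by linarith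
  then have "real (card P * (2 * k) + 2 ^ (k + 2)) \<le> real (K + 2)" by simp
  then have cap: "card P * (2 * k) + 2 ^ (k + 2) \<le> K + 2" by (simp only: of_nat_le_iff)
  have "\<exists>a b. p = {a,b} \<and> a \<noteq> b \<and> a \<in> W \<and> b \<in> W" if "p \<in> P" for p
  proof -
    obtain a b where "p = {a,b}" "a \<noteq> b" using P(2) \<open>p \<in> P\<close> by blast
    moreover have "p \<subseteq> W" using \<open>p \<in> P\<close> unfolding W_def by blast
    ultimately show ?thesis by auto
  qed
  from connect_all[OF P(1) this _ P(4) cap k] P(3)
  obtain par path where r: "routed k P par path" by blast
  have paths: "\<forall>p\<in>P. \<exists>a b. p = {a,b} \<and> alt_path E M a b (path p)"
    and disj: "\<forall>p\<in>P. \<forall>q\<in>P. p \<noteq> q \<longrightarrow> set (path_verts (path p)) \<inter> set (path_verts (path q)) = {}"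
    using r unfolding routed_def by simp_all
  \<comment> \<open>An unordered pair does not determine which endpoint was taken as the start,
    hence the disjunction.\<close>
  have "alt_path E M a b (path {a,b}) \<or> alt_path E M b a (path {a,b})" if ab: "{a,b} \<in> P" for a b
  proof -
    obtain a' b' where "{a,b} = {a',b'}" "alt_path E M a' b' (path {a,b})" using bspec[OF paths ab] by blast
    then show ?thesis by (auto simp: doubleton_eq_iff)
  qed
  then show ?thesis using disj by blast
qed

theorem theorem3p18:
  shows "\<exists>N::nat. \<forall>n\<ge>N. \<forall>(d::nat) (lam::real) E M P.
    ndl_graph n d lam E \<and> real d > 500 * lam \<and>
    disjoint_pairs n M \<and> clean E (500 * lam) (\<Union>M) \<and>
    real (card M) \<ge> 2000 * lam * real n / real d \<and>
    finite P \<and>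
    (\<forall>p\<in>P. \<exists>a b. p = {a, b} \<and> a \<noteq> b \<and> a < n \<and> b < n) \<and>
    (\<forall>p\<in>P. \<forall>q\<in>P. p \<noteq> q \<longrightarrow> p \<inter> q = {}) \<and>
    \<Union>P \<inter> \<Union>M = {} \<and>
    real (card P) \<le> real (card M) / (100 * log 2 (real n)) \<and>
    (\<forall>v\<in>\<Union>P. real (card (nbhd E v \<inter> \<Union>M)) \<ge> 500 * lam)
    \<longrightarrow> (\<exists>path :: nat set \<Rightarrow> (nat \<times> nat) list.
          (\<forall>a b. {a, b} \<in> P \<longrightarrow> alt_path E M a b (path {a, b}) \<or> alt_path E M b a (path {a, b})) \<and>
          (\<forall>p\<in>P. \<forall>q\<in>P. p \<noteq> q \<longrightarrow> set (path_verts (path p)) \<inter> set (path_verts (path q)) = {}))"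
proof (intro exI[of _ 0] allI impI, elim conjE)
  \<comment> \<open>The witness for \<open>N\<close> is \<open>0\<close>: the estimates take
    \<open>n \<ge> 2\<close>, and with it \<open>log 2 n \<ge> 1\<close>, from
    \<open>ndl_graph\<close>.\<close>
  fix n d :: nat and lam :: real and E M P
  assume "ndl_graph n d lam E" "real d > 500 * lam" "disjoint_pairs n M" "clean E (500 * lam) (\<Union>M)"
    "real (card M) \<ge> 2000 * lam * real n / real d" "finite P"
    "\<forall>p\<in>P. \<exists>a b. p = {a, b} \<and> a \<noteq> b \<and> a < n \<and> b < n"
    "\<forall>p\<in>P. \<forall>q\<in>P. p \<noteq> q \<longrightarrow> p \<inter> q = {}" "\<Union>P \<inter> \<Union>M = {}"
    "real (card P) \<le> real (card M) / (100 * log 2 (real n))"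
    "\<forall>v\<in>\<Union>P. real (card (nbhd E v \<inter> \<Union>M)) \<ge> 500 * lam"
  then show "\<exists>path :: nat set \<Rightarrow> (nat \<times> nat) list.
      (\<forall>a b. {a, b} \<in> P \<longrightarrow> alt_path E M a b (path {a, b}) \<or> alt_path E M b a (path {a, b})) \<and>
      (\<forall>p\<in>P. \<forall>q\<in>P. p \<noteq> q \<longrightarrow> set (path_verts (path p)) \<inter> set (path_verts (path q)) = {})"
    by (rule expander_alternating_paths)
qed

end
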